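(* Let $m\geq 1$ and let $\mathcal{P}_m$ be the manifold of real symmetric positive definite $m\times m$ matrices equipped with the trace (affine invariant) metric. Then the radial fields on $\mathcal{P}_m$ are smooth; that is, for every $\xi\in\partial\mathcal{P}_m$, the vector field $x\mapsto\xi_x$ on $\mathcal{P}_m$ is $C^\infty$.
   Context: $\mathcal{S}_m$ is the vector space of real symmetric $m\times m$ matrices and $\mathcal{P}_m$ the space of real symmetric positive definite $m\times m$ matrices, a smooth manifold of dimension $m(m+1)/2$ with $T_x\mathcal{P}_m\cong\mathcal{S}_m$ at each $x$; thus a vector field on $\mathcal{P}_m$ may be regarded as a map $\mathcal{P}_m\to\mathcal{S}_m\cong\mathbb{R}^{m(m+1)/2}$. The trace metric is $\langle v_1,v_2\rangle=\mathrm{tr}(x^{-1}v_1x^{-1}v_2)$ for $v_1,v_2\in T_x\mathcal{P}_m$; with it, $\mathcal{P}_m$ is a Hadamard manifold (complete, simply connected, non-positive sectional curvature). With this metric the Riemannian exponential map is $\exp_x(v)=x^{1/2}\mathrm{Exp}(x^{-1/2}vx^{-1/2})x^{1/2}$, and the distance is $d(x,p)=\lVert\mathrm{Log}(x^{-1/2}px^{-1/2})\rVert_F$, where $\mathrm{Exp}$ is the matrix exponential, $\mathrm{Log}$ is the symmetric matrix logarithm of a symmetric positive definite matrix, $x^{1/2}$ is the symmetric positive definite square root, and $\lVert\cdot\rVert_F$ is the Frobenius norm. Boundary at infinity and radial fields: in a Hadamard manifold $M$ with distance $d$, two unit-speed geodesic rays $\gamma_1,\gamma_2:[0,\infty)\to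 M$ are asymptotic if $t\mapsto d(\gamma_1(t),\gamma_2(t))$ is bounded on $[0,\infty)$. This is an equivalence relation, and $\partial M$ (the boundary at infinity) is the set of its equivalence classes. For every $\xi\in\partial M$ and $x\in M$ there is a unique ray $\gamma_x\in\xi$ with $\gamma_x(0)=x$; put $\xi_x:=\gamma_x'(0)\in T_xM$, a unit vector. The vector field $x\mapsto\xi_x$ is called the radial field of $\xi$. *)

theory Defs
  imports "HOL-Analysis.Analysis" "HOL-Library.FuncSet"
begin

section \<open>Symmetric and positive definite matrices\<close>

definition sym_mats :: "(real^'m^'m) set" where
  "sym_mats = {A. transpose A = A}"

definition pd_mats :: "(real^'m^'m) set" where
  "pd_mats = {A \<in> sym_mats. \<forall>u. u \<noteq> 0 \<longrightarrow> 0 < u \<bullet> (A *v u)}"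

text \<open>The library's multiplication, power and exponential do not apply here: on
  the type of matrices, multiplication is componentwise, and the type is not a
  normed algebra. So the exponential series is written with the matrix product.\<close>

definition mat_power :: "real^'m^'m \<Rightarrow> nat \<Rightarrow> real^'m^'m" where
  "mat_power A n = (((**) A) ^^ n) (mat 1)"

definition mat_exp :: "real^'m^'m \<Rightarrow> real^'m^'m" where
  "mat_exp A = (\<Sum>n. (1 / fact n) *\<^sub>R mat_power A n)"

text \<open>The next three are meaningful for a positive definite argument, for which the
  described matrix exists and is unique.\<close>

definition mat_log :: "real^'m^'m \<Rightarrow> real^'m^'m" where
  "mat_log A = (THE B. B \<in> sym_mats \<and> mat_exp B = A)"

definition mat_sqrt :: "real^'m^'m \<Rightarrow> real^'m^'m" where
  "mat_sqrt A = (THE B. B \<in> pd_mats \<and> B ** B = A)"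

definition mat_inv_sqrt :: "real^'m^'m \<Rightarrow> real^'m^'m" where
  "mat_inv_sqrt A = matrix_inv (mat_sqrt A)"

definition frobenius_norm :: "real^'m^'m \<Rightarrow> real" where
  "frobenius_norm A = sqrt (\<Sum>i\<in>UNIV. \<Sum>j\<in>UNIV. (A $ i $ j)\<^sup>2)"

section \<open>The geometry of the trace metric\<close>

text \<open>The manifold is \<^const>\<open>pd_mats\<close>, and its tangent space at every point is
  \<^const>\<open>sym_mats\<close>.\<close>

definition trace_metric :: "real^'m^'m \<Rightarrow> real^'m^'m \<Rightarrow> real^'m^'m \<Rightarrow> real" where
  "trace_metric x v w = trace (matrix_inv x ** v ** matrix_inv x ** w)"

definition riem_exp :: "real^'m^'m \<Rightarrow> real^'m^'m \<Rightarrow> real^'m^'m" where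
  "riem_exp x v =
     mat_sqrt x ** mat_exp (mat_inv_sqrt x ** v ** mat_inv_sqrt x) ** mat_sqrt x"

definition riem_dist :: "real^'m^'m \<Rightarrow> real^'m^'m \<Rightarrow> real" where
  "riem_dist x p = frobenius_norm (mat_log (mat_inv_sqrt x ** p ** mat_inv_sqrt x))"

text \<open>Rays are restricted to the half-line (they are \<^const>\<open>undefined\<close> at negative
  arguments), so that two rays are equal iff they agree at all nonnegative times.\<close>

definition unit_rays :: "(real \<Rightarrow> real^'m^'m) set" where
  "unit_rays = {\<gamma>. \<exists>x\<in>pd_mats. \<exists>v\<in>sym_mats. trace_metric x v v = 1 \<and>
                    \<gamma> = (\<lambda>t\<in>{0..}. riem_exp x (t *\<^sub>R v))}"

definition asymptotic_rays :: "(real \<Rightarrow> real^'m^'m) rel" where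
  "asymptotic_rays = {(\<gamma>, \<gamma>'). \<gamma> \<in> unit_rays \<and> \<gamma>' \<in> unit_rays \<and>
                               bounded ((\<lambda>t. riem_dist (\<gamma> t) (\<gamma>' t)) ` {0..})}"

definition boundary_at_infinity :: "(real \<Rightarrow> real^'m^'m) set set" where
  "boundary_at_infinity = unit_rays // asymptotic_rays"

definition ray_from :: "(real \<Rightarrow> real^'m^'m) set \<Rightarrow> real^'m^'m \<Rightarrow> real \<Rightarrow> real^'m^'m" where
  "ray_from \<xi> x = (THE \<gamma>. \<gamma> \<in> \<xi> \<and> \<gamma> 0 = x)"

definition radial_field :: "(real \<Rightarrow> real^'m^'m) set \<Rightarrow> real^'m^'m \<Rightarrow> real^'m^'m" where
  "radial_field \<xi> x = vector_derivative (ray_from \<xi> x) (at 0 within {0..})"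

section \<open>Smooth maps on a relatively open subset of a subspace\<close>

text \<open>Here \<open>S\<close> is a linear subspace and \<open>U\<close> is a subset of \<open>S\<close> that is open in \<open>S\<close>.
  The derivative \<open>f' x\<close> is then determined by \<open>f\<close> only on \<open>S\<close>, so only the directions
  \<open>v \<in> S\<close> are used: \<open>f\<close> is of class \<open>C\<^sup>k\<^sup>+\<^sup>1\<close> iff it is differentiable and all its
  derivatives in directions of \<open>S\<close> are of class \<open>C\<^sup>k\<close>.\<close>

primrec Ck_on ::
  "nat \<Rightarrow> 'a set \<Rightarrow> 'a set \<Rightarrow> ('a::euclidean_space \<Rightarrow> 'b::real_normed_vector) \<Rightarrow> bool" where
  "Ck_on 0 S U f \<longleftrightarrow> continuous_on U f"
| "Ck_on (Suc k) S U f \<longleftrightarrow>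
     (\<exists>f'. (\<forall>x\<in>U. (f has_derivative f' x) (at x within U)) \<and>
           (\<forall>v\<in>S. Ck_on k S U (\<lambda>x. f' x v)))"

definition smooth_in ::
  "'a set \<Rightarrow> 'a set \<Rightarrow> ('a::euclidean_space \<Rightarrow> 'b::real_normed_vector) \<Rightarrow> bool" where
  "smooth_in S U f \<longleftrightarrow> (\<forall>k. Ck_on k S U f)"

end

(*
Write a ray as t |-> g exp(tD) g^T with g invertible and D diagonal. Two rays are asymptotic iff
each is bounded, uniformly in t, by a constant times the other in the Loewner order. Operator
monotonicity of the logarithm then shows that asymptotic rays with a common origin coincide.
For existence, factor a given point as x = (g T)(g T)^T with T triangular with respect to the
order of the entries of D: conjugating T by exp(tD/2) keeps it bounded as t grows, so the ray
t |-> (g T) exp(tD) (g T)^T through x is asymptotic to the given one, and the radial field at x is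
g (T D T^T) g^T. The factor T can be eliminated from this formula. If Q is the coordinate
projection onto a member of the flag stabilised by T, and y = T T^T, then
T Q T^T = (Q y^-1 Q + 1 - Q)^-1 - (1 - Q), and D is a linear combination of such projections Q.
*)

theory Submission
  imports Defs
begin

text \<open>The distance is the Euclidean norm of the logarithms of the eigenvalues of one point
  relative to the other, so it is bounded along two rays exactly when these eigenvalues stay in some
  interval [1/c, c]; this is why asymptoticity can be expressed in the Loewner order. For a common
  origin, moved to the identity by a congruence, taking logarithms turns the factor c into a summand
  ln c, which is negligible against terms linear in t; hence the initial velocities bound each
  other. The obstacle to smoothness is that T is chosen separately at each point and may be replaced
  by T K with K orthogonal and commuting with D. The matrix T Q T^T does not see this choice. The
  range of Q is invariant under T and its inverse, so on that subspace T Q T^T inverts the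
  compression Q y^-1 Q; the summand 1 - Q only completes the compression to an invertible matrix.
  With y = g^-1 x g^-T the field becomes a rational function of the entries of x, and its smoothness
  reduces to Cramer's rule.\<close>

section \<open>Matrix algebra: transposes, distributivity, inverses\<close>

lemma transpose_diff: "transpose (A - B) = transpose A - transpose (B :: 'a::minus^'n^'m)"
  by (simp add: transpose_def vec_eq_iff)

lemma matrix_add_rdistrib: "((A :: 'a::semiring_1^'n^'m) + B) ** C = A ** C + B ** C"
  by (simp add: matrix_matrix_mult_def vec_eq_iff distrib_right sum.distrib)

lemma matrix_diff_ldistrib: "(A :: 'a::ring_1^'n^'m) ** (B - C) = A ** B - A ** C"
  by (simp add: matrix_matrix_mult_def vec_eq_iff right_diff_distrib sum_subtractf)

lemma matrix_diff_rdistrib: "((A :: 'a::ring_1^'n^'m) - B) ** C = A ** C - B ** C"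
  by (simp add: matrix_matrix_mult_def vec_eq_iff left_diff_distrib sum_subtractf)

lemma dot_matrix_vector_transpose:
  "(u :: real^'m) \<bullet> (A *v w) = (transpose A *v u) \<bullet> w"
  by (simp add: dot_lmul_matrix)

text \<open>A one-sided inverse of a square matrix is two-sided and unique, so the choice in
  \<open>matrix_inv\<close> has only one possible value.\<close>

lemma matrix_inv_eqI:
  fixes A B :: "real^'m^'m"
  assumes "A ** B = mat 1"
  shows "matrix_inv A = B"
proof -
  have BA: "B ** A = mat 1"
    using assms matrix_left_right_inverse by blast
  with assms have "A ** B = mat 1 \<and> B ** A = mat 1"
    by blast
  then have "A ** matrix_inv A = mat 1 \<and> matrix_inv A ** A = mat 1"
    unfolding matrix_inv_def by (rule someI)
  then show ?thesis
    by (metis BA matrix_mul_assoc matrix_mul_lid matrix_mul_rid)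
qed

lemma
  fixes A :: "real^'m^'m"
  assumes "invertible A"
  shows matrix_mul_inv_right: "A ** matrix_inv A = mat 1"
    and matrix_mul_inv_left: "matrix_inv A ** A = mat 1"
proof -
  obtain B where "A ** B = mat 1" "B ** A = mat 1"
    using assms by (auto simp: invertible_def)
  then show "A ** matrix_inv A = mat 1" "matrix_inv A ** A = mat 1"
    using matrix_inv_eqI by auto
qed

lemma invertible_mult_eq_0: "A *v u = 0 \<longleftrightarrow> u = 0" if "invertible (A :: real^'m^'m)"
  by (metis that matrix_left_invertible_ker matrix_mul_inv_left matrix_vector_mult_0_right)

section \<open>Congruences of diagonal matrices\<close>

definition diag :: "('m \<Rightarrow> real) \<Rightarrow> real^'m^'m" where
  "diag d = (\<chi> i j. if i = j then d i else 0)"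

text \<open>For orthogonal \<open>g\<close> this is a spectral decomposition; for
  \<open>g ** transpose g = x\<close> it is a tangent vector at \<open>x\<close> or a point of a
  geodesic through \<open>x\<close>. One formula thus serves functional calculus and rays
  alike.\<close>

definition cdiag :: "real^'m^'m \<Rightarrow> ('m \<Rightarrow> real) \<Rightarrow> real^'m^'m" where
  "cdiag g d = g ** diag d ** transpose g"

lemma diag_nth: "diag d $ i $ j = (if i = j then d i else 0)"
  by (simp add: diag_def)

lemma transpose_diag [simp]: "transpose (diag d) = diag d"
  by (simp add: diag_def transpose_def vec_eq_iff)

lemma diag_one: "diag (\<lambda>_. 1) = mat 1"
  by (simp add: diag_def mat_def)

lemma matrix_mult_diag_nth: "(A ** diag d) $ i $ j = A $ i $ j * d j"
proof -
  have "(A ** diag d) $ i $ j = (\<Sum>k\<in>UNIV. if k = j then A $ i $ k * d k else 0)"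
    unfolding matrix_matrix_mult_def vec_lambda_beta by (rule sum.cong) (auto simp: diag_nth)
  then show ?thesis
    by simp
qed

lemma diag_matrix_mult_nth: "(diag d ** A) $ i $ j = d i * A $ i $ j"
proof -
  have "(diag d ** A) $ i $ j = (\<Sum>k\<in>UNIV. if k = i then d i * A $ k $ j else 0)"
    unfolding matrix_matrix_mult_def vec_lambda_beta by (rule sum.cong) (auto simp: diag_nth)
  then show ?thesis
    by simp
qed

lemma diag_mult_vector_nth: "(diag d *v u) $ i = d i * u $ i"
proof -
  have "(diag d *v u) $ i = (\<Sum>k\<in>UNIV. if k = i then d i * u $ k else 0)"
    unfolding matrix_vector_mult_def vec_lambda_beta by (rule sum.cong) (auto simp: diag_nth)
  then show ?thesis
    by simp
qed

lemma diag_mult: "diag a ** diag b = diag (\<lambda>i. a i * b i)"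
  by (simp add: vec_eq_iff matrix_mult_diag_nth diag_nth)

lemma cdiag_nth: "cdiag g d $ i $ j = (\<Sum>k\<in>UNIV. d k * (g $ i $ k * g $ j $ k))"
  unfolding cdiag_def
  by (subst matrix_matrix_mult_def)
     (auto simp: matrix_mult_diag_nth transpose_def ac_simps intro: sum.cong)

lemma transpose_cdiag [simp]: "transpose (cdiag g d) = cdiag g d"
  by (simp add: cdiag_def matrix_transpose_mul matrix_mul_assoc)

lemma cdiag_in_sym_mats: "cdiag g d \<in> sym_mats"
  by (simp add: sym_mats_def)

lemma cdiag_one: "cdiag g (\<lambda>_. 1) = g ** transpose g"
  by (simp add: cdiag_def diag_one)

lemma cdiag_congruence: "h ** cdiag g d ** transpose h = cdiag (h ** g) d"
  by (simp add: cdiag_def matrix_transpose_mul matrix_mul_assoc)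

lemma cdiag_scaleR: "c *\<^sub>R cdiag g d = cdiag g (\<lambda>i. c * d i)"
  by (simp add: vec_eq_iff cdiag_nth sum_distrib_left ac_simps)

lemma cdiag_mult:
  assumes "orthogonal_matrix U"
  shows "cdiag U a ** cdiag U b = cdiag U (\<lambda>i. a i * b i)"
proof -
  have "cdiag U a ** cdiag U b = U ** diag a ** (transpose U ** U) ** diag b ** transpose U"
    by (simp add: cdiag_def matrix_mul_assoc)
  also have "\<dots> = U ** (diag a ** diag b) ** transpose U"
    using assms by (simp add: orthogonal_matrix_def matrix_mul_assoc)
  finally show ?thesis
    by (simp add: cdiag_def diag_mult)
qed

lemma trace_cdiag:
  assumes "orthogonal_matrix U"
  shows "trace (cdiag U d) = (\<Sum>i\<in>UNIV. d i)"
proof -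
  have "trace (cdiag U d) = trace (transpose U ** (U ** diag d))"
    unfolding cdiag_def by (rule trace_mul_sym)
  also have "\<dots> = trace (diag d)"
    using assms by (simp add: orthogonal_matrix_def matrix_mul_assoc)
  finally show ?thesis
    by (simp add: trace_def diag_nth)
qed

lemma inner_cdiag: "u \<bullet> (cdiag g d *v u) = (\<Sum>i\<in>UNIV. d i * ((transpose g *v u) $ i)\<^sup>2)"
proof -
  have "u \<bullet> (cdiag g d *v u) = u \<bullet> (g *v (diag d *v (transpose g *v u)))"
    \<comment> \<open>The simp rule \<open>transpose_matrix_vector\<close> would turn
      \<open>transpose g *v u\<close> into \<open>u v* g\<close>; deleting it, here and in later
      proofs, preserves the form used in the statement.\<close>
    by (simp add: cdiag_def matrix_vector_mul_assoc matrix_mul_assoc del: transpose_matrix_vector)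
  also have "\<dots> = (transpose g *v u) \<bullet> (diag d *v (transpose g *v u))"
    by (rule dot_matrix_vector_transpose)
  also have "\<dots> = (\<Sum>i\<in>UNIV. d i * ((transpose g *v u) $ i)\<^sup>2)"
    by (simp add: inner_vec_def diag_mult_vector_nth power2_eq_square ac_simps del: transpose_matrix_vector)
  finally show ?thesis .
qed

lemma orthogonal_matrix_invertible: "orthogonal_matrix U \<Longrightarrow> invertible U"
  by (auto simp: orthogonal_matrix_def invertible_def)

lemma cdiag_in_pd_mats:
  assumes "invertible g" and d: "\<And>i. d i > 0"
  shows "cdiag g d \<in> pd_mats"
proof -
  have "0 < u \<bullet> (cdiag g d *v u)" if "u \<noteq> 0" for u
  proof -
    define w where "w = transpose g *v u"
    have "w \<noteq> 0"
      using assms(1) that unfolding w_def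
      by (metis invertible_mult_eq_0 transpose_invertible)
    then obtain k where k: "w $ k \<noteq> 0"
      by (metis vec_eq_iff zero_index)
    have "0 < d k * (w $ k)\<^sup>2"
      using d k by simp
    also have "\<dots> \<le> (\<Sum>i\<in>UNIV. d i * (w $ i)\<^sup>2)"
      by (rule member_le_sum) (use d in \<open>auto simp: less_imp_le\<close>)
    finally show ?thesis
      by (simp only: inner_cdiag w_def)
  qed
  then show ?thesis
    by (simp add: pd_mats_def cdiag_in_sym_mats)
qed

lemma pd_mats_transpose: "A \<in> pd_mats \<Longrightarrow> transpose A = A"
  by (simp add: pd_mats_def sym_mats_def)

lemma pd_mats_pos: "A \<in> pd_mats \<Longrightarrow> u \<noteq> 0 \<Longrightarrow> 0 < u \<bullet> (A *v u)"
  by (simp add: pd_mats_def)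

lemma pd_mats_nonneg: "A \<in> pd_mats \<Longrightarrow> 0 \<le> u \<bullet> (A *v u)"
  by (cases "u = 0") (auto simp: less_imp_le pd_mats_pos)

lemma pd_mats_invertible:
  assumes "A \<in> pd_mats"
  shows "invertible A"
proof -
  have "u = 0" if "A *v u = 0" for u
    using pd_mats_pos[OF assms, of u] that by force
  then show ?thesis
    by (simp add: invertible_left_inverse matrix_left_invertible_ker)
qed

lemma congruence_in_pd_mats:
  fixes A g :: "real^'m^'m"
  assumes "A \<in> pd_mats" "invertible g"
  shows "g ** A ** transpose g \<in> pd_mats"
proof -
  have "u \<bullet> ((g ** A ** transpose g) *v u) = (transpose g *v u) \<bullet> (A *v (transpose g *v u))" for u
    by (simp only: matrix_vector_mul_assoc[symmetric] dot_matrix_vector_transpose)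
  moreover have "transpose g *v u \<noteq> 0" if "u \<noteq> 0" for u
    using that assms(2) by (metis invertible_mult_eq_0 transpose_invertible)
  ultimately show ?thesis
    using assms(1)
    by (simp add: pd_mats_def sym_mats_def matrix_transpose_mul matrix_mul_assoc
        del: transpose_matrix_vector)
qed

section \<open>The spectral theorem\<close>

text \<open>A maximiser \<open>x\<close> of the Rayleigh quotient on the unit sphere of
  \<open>W\<close> is an eigenvector. With \<open>c\<close> the maximum, the form \<open>B\<close>
  is positive semidefinite on \<open>W\<close> and vanishes at \<open>x\<close>. Pairing
  \<open>x\<close> with the residual \<open>c *\<^sub>R x - A *v x\<close>, which lies in
  \<open>W\<close> by invariance, gives the squared norm of the residual.\<close>

lemma symmetric_eigenvector_in_invariant_subspace:
  fixes A :: "real^'m^'m"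
  assumes sym: "transpose A = A" and W: "subspace W" and inv: "\<And>w. w \<in> W \<Longrightarrow> A *v w \<in> W"
    and "W \<noteq> {0}"
  obtains x c where "x \<in> W" "norm x = 1" "A *v x = c *\<^sub>R x"
proof -
  define K where "K = W \<inter> sphere 0 1"
  obtain y where y: "y \<in> W" "y \<noteq> 0"
    using assms(2,4) subspace_0 by blast
  have "(1 / norm y) *\<^sub>R y \<in> K"
    using y W by (simp add: K_def subspace_scale)
  then have "K \<noteq> {}"
    by blast
  moreover have "compact K"
    unfolding K_def by (intro closed_Int_compact closed_subspace W) simp
  moreover have "continuous_on K (\<lambda>x. x \<bullet> (A *v x))"
    by (intro continuous_intros linear_continuous_on) auto
  ultimately obtain x where x: "x \<in> K" and max: "\<And>y. y \<in> K \<Longrightarrow> y \<bullet> (A *v y) \<le> x \<bullet> (A *v x)"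
    by (meson continuous_attains_sup)
  define c where "c = x \<bullet> (A *v x)"
  define B where "B u v = c * (u \<bullet> v) - u \<bullet> (A *v v)" for u v
  have xW: "x \<in> W" and nx: "norm x = 1"
    using x by (auto simp: K_def)
  have B_sym: "B u v = B v u" for u v
    using dot_matrix_vector_transpose[of u A v] sym
    by (simp add: B_def inner_commute del: transpose_matrix_vector)
  have B_nonneg: "0 \<le> B w w" if "w \<in> W" for w
  proof (cases "w = 0")
    case False
    then have "(1 / norm w) *\<^sub>R w \<in> K"
      using that W by (simp add: K_def subspace_scale)
    from max[OF this] have "(w \<bullet> (A *v w)) / (norm w)\<^sup>2 \<le> c"
      by (simp add: c_def matrix_vector_mult_scaleR power2_eq_square)
    then show ?thesis
      using False by (simp add: B_def divide_le_eq power2_norm_eq_inner)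
  qed (simp add: B_def)
  have B_x: "B x x = 0"
    using nx by (simp add: B_def c_def norm_eq_1)
  \<comment> \<open>An isotropic vector of a positive semidefinite form lies in its radical.\<close>
  have "B x w = 0" if w: "w \<in> W" for w
  proof (rule ccontr)
    assume ne: "B x w \<noteq> 0"
    have expand: "B (x + t *\<^sub>R w) (x + t *\<^sub>R w) = 2 * t * B x w + t\<^sup>2 * B w w" for t
    proof -
      have "w \<bullet> (A *v x) = x \<bullet> (A *v w)"
        using B_sym[of w x] by (simp add: B_def inner_commute)
      then have "B (x + t *\<^sub>R w) (x + t *\<^sub>R w) = B x x + 2 * t * B x w + t\<^sup>2 * B w w"
        by (simp add: B_def matrix_vector_right_distrib matrix_vector_mult_scaleR inner_simps
            inner_commute[of w x] algebra_simps power2_eq_square)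
      then show ?thesis
        using B_x by simp
    qed
    have pos: "0 \<le> 2 * t * B x w + t\<^sup>2 * B w w" for t
      unfolding expand[symmetric] using w xW W by (intro B_nonneg subspace_add subspace_scale)
    \<comment> \<open>Almost the minimiser of the quadratic in \<open>t\<close>; the
      \<open>+ 1\<close> keeps the denominator positive when \<open>B w w = 0\<close>.\<close>
    define t where "t = - B x w / (B w w + 1)"
    have Bw: "0 \<le> B w w"
      using B_nonneg w by blast
    have b: "B x w = - (t * (B w w + 1))"
      using Bw by (simp add: t_def)
    have "2 * t * B x w + t\<^sup>2 * B w w = - (t\<^sup>2 * (B w w + 2))"
      unfolding b by (simp add: algebra_simps power2_eq_square)
    then have "t\<^sup>2 * (B w w + 2) \<le> 0"
      using pos[of t] by simp
    then have "t = 0"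
      using Bw by (auto simp: mult_le_0_iff)
    then show False
      using ne b by simp
  qed
  moreover have res: "c *\<^sub>R x - A *v x \<in> W"
    using xW inv W by (simp add: subspace_diff subspace_scale)
  ultimately have "B x (c *\<^sub>R x - A *v x) = 0"
    by blast
  then have "(c *\<^sub>R x - A *v x) \<bullet> (c *\<^sub>R x - A *v x) = 0"
    by (subst (asm) B_sym) (simp add: B_def inner_diff_right)
  then have "A *v x = c *\<^sub>R x"
    by simp
  then show thesis
    using that xW nx by blast
qed

text \<open>Orthonormal eigenvectors are collected one at a time: the orthogonal complement of those
  found is invariant because \<open>A\<close> is symmetric, and it is nonzero as long as there are
  fewer than \<open>CARD('m)\<close> of them.\<close>

theorem spectral_theorem:
  fixes A :: "real^'m^'m"
  assumes sym: "A \<in> sym_mats"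
  obtains U d where "orthogonal_matrix U" "A = cdiag U d"
proof -
  have tA: "transpose A = A"
    using sym by (simp add: sym_mats_def)
  have "\<exists>E. finite E \<and> card E = n \<and> pairwise orthogonal E \<and> (\<forall>e\<in>E. norm e = 1 \<and> (\<exists>c. A *v e = c *\<^sub>R e))"
    if "n \<le> CARD('m)" for n
    using that
  proof (induction n)
    case 0
    show ?case
      by (intro exI[of _ "{}"]) auto
  next
    case (Suc n)
    then obtain E where E: "finite E" "card E = n" "pairwise orthogonal E"
      "\<And>e. e \<in> E \<Longrightarrow> norm e = 1" "\<And>e. e \<in> E \<Longrightarrow> \<exists>c. A *v e = c *\<^sub>R e"
      by auto
    define W where "W = {w. \<forall>e\<in>E. orthogonal e w}"
    have W: "subspace W"
      unfolding W_def by (auto simp: subspace_def orthogonal_clauses)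
    have inv: "A *v w \<in> W" if w: "w \<in> W" for w
    proof -
      have "e \<bullet> (A *v w) = 0" if e: "e \<in> E" for e
      proof -
        obtain c where c: "A *v e = c *\<^sub>R e"
          using E(5) e by blast
        have "e \<bullet> (A *v w) = (A *v e) \<bullet> w"
          using dot_matrix_vector_transpose[of e A w] tA by (simp del: transpose_matrix_vector)
        then show ?thesis
          using c w e by (simp add: W_def orthogonal_def)
      qed
      then show ?thesis
        by (simp add: W_def orthogonal_def)
    qed
    have "dim (span E) < DIM(real^'m)"
      using dim_le_card'[OF E(1)] E(2) Suc.prems by simp
    then obtain y where "y \<noteq> 0" "\<And>e. e \<in> span (span E) \<Longrightarrow> orthogonal y e"
      using orthogonal_to_subspace_exists[of "span E"] by blast
    then have "y \<in> W"
      by (auto simp: W_def orthogonal_commute span_base)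
    then have "W \<noteq> {0}"
      using \<open>y \<noteq> 0\<close> by blast
    then obtain x c where x: "x \<in> W" "norm x = 1" "A *v x = c *\<^sub>R x"
      using symmetric_eigenvector_in_invariant_subspace[OF tA W inv] by metis
    have "x \<notin> E"
      using x by (auto simp: W_def orthogonal_self)
    have "pairwise orthogonal (insert x E)"
      using E(3) x(1) by (auto simp: pairwise_insert W_def orthogonal_commute)
    then show ?case
      using E x \<open>x \<notin> E\<close> by (intro exI[of _ "insert x E"]) auto
  qed
  from this[of "CARD('m)"] obtain E :: "(real^'m) set" where E: "finite E" "card E = CARD('m)"
    "pairwise orthogonal E" "\<And>e. e \<in> E \<Longrightarrow> norm e = 1" "\<And>e. e \<in> E \<Longrightarrow> \<exists>c. A *v e = c *\<^sub>R e"
    by auto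
  obtain f where f: "bij_betw f (UNIV :: 'm set) E"
    using finite_same_card_bij[OF finite_class.finite_UNIV E(1)] E(2) by auto
  have fE: "f j \<in> E" for j
    using f by (auto simp: bij_betw_def)
  have "\<forall>j. \<exists>c. A *v f j = c *\<^sub>R f j"
    using E(5) fE by blast
  then obtain d where d: "\<And>j. A *v f j = d j *\<^sub>R f j"
    unfolding choice_iff by blast
  define U where "U = (\<chi> i j. f j $ i)"
  have col: "column j U = f j" for j
    by (simp add: U_def column_def)
  have orth: "orthogonal_matrix U"
    unfolding orthogonal_matrix_orthonormal_columns col
  proof (intro conjI allI impI)
    fix i j :: 'm
    assume "i \<noteq> j"
    then have "f i \<noteq> f j"
      using f by (auto simp: bij_betw_def inj_on_def)
    then show "orthogonal (f i) (f j)"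
      using E(3) fE by (simp add: pairwise_def)
  qed (use E(4) fE in blast)
  have "(A ** U) $ i $ j = (A *v f j) $ i" for i j
    by (simp add: matrix_matrix_mult_def matrix_vector_mult_def U_def)
  then have "(A ** U) $ i $ j = (U ** diag d) $ i $ j" for i j
    by (simp add: d matrix_mult_diag_nth U_def)
  then have "A ** U = U ** diag d"
    by (simp add: vec_eq_iff)
  then have "A ** (U ** transpose U) = cdiag U d"
    by (simp add: cdiag_def matrix_mul_assoc)
  then have "A = cdiag U d"
    using orth by (simp add: orthogonal_matrix_def)
  then show thesis
    using that orth by blast
qed

lemma pd_mats_spectral:
  assumes "x \<in> pd_mats"
  obtains U d where "orthogonal_matrix U" "x = cdiag U d" "\<And>i. 0 < d i"
proof -
  obtain U d where U: "orthogonal_matrix U" "x = cdiag U d"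
    using assms spectral_theorem by (auto simp: pd_mats_def)
  have "0 < d k" for k
  proof -
    define u where "u = U *v axis k 1"
    have w: "transpose U *v u = axis k 1"
      using U(1) by (simp add: u_def matrix_vector_mul_assoc orthogonal_matrix_def del: transpose_matrix_vector)
    then have "u \<noteq> 0"
      by (auto simp: axis_eq_0_iff simp del: transpose_matrix_vector)
    then have "0 < u \<bullet> (x *v u)"
      using assms pd_mats_pos by blast
    also have "\<dots> = (\<Sum>i\<in>UNIV. if i = k then d i else 0)"
      unfolding U(2) inner_cdiag w by (rule sum.cong) (auto simp: axis_def)
    finally show ?thesis
      by simp
  qed
  then show thesis
    using that U by blast
qed

section \<open>The exponential of a symmetric matrix\<close>

lemma mat_power_cdiag:
  assumes "orthogonal_matrix U"
  shows "mat_power (cdiag U d) n = cdiag U (\<lambda>i. d i ^ n)"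
proof (induction n)
  case 0
  then show ?case
    using assms by (simp add: mat_power_def cdiag_one orthogonal_matrix_def)
next
  case (Suc n)
  then show ?case
    using assms by (simp add: mat_power_def cdiag_mult)
qed

lemma sums_vecI:
  assumes "\<And>i. (\<lambda>n. f n $ i) sums (s $ i)"
  shows "f sums (s :: 'a::real_normed_vector^'n)"
  unfolding sums_def
proof (rule vec_tendstoI)
  fix i
  show "(\<lambda>n. (\<Sum>k<n. f k) $ i) \<longlonglongrightarrow> s $ i"
    using assms[of i] by (simp add: sums_def)
qed

lemma mat_exp_cdiag:
  assumes "orthogonal_matrix U"
  shows "mat_exp (cdiag U d) = cdiag U (\<lambda>i. exp (d i))"
proof -
  have "(\<lambda>n. (1 / fact n) *\<^sub>R mat_power (cdiag U d) n) sums cdiag U (\<lambda>i. exp (d i))"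
  proof (intro sums_vecI)
    fix i j
    have "(\<lambda>n. \<Sum>k\<in>UNIV. (d k ^ n /\<^sub>R fact n) * (U $ i $ k * U $ j $ k))
            sums (\<Sum>k\<in>UNIV. exp (d k) * (U $ i $ k * U $ j $ k))"
      by (intro sums_sum sums_mult2 exp_converges)
    then show "(\<lambda>n. ((1 / fact n) *\<^sub>R mat_power (cdiag U d) n) $ i $ j)
            sums (cdiag U (\<lambda>i. exp (d i)) $ i $ j)"
      by (simp add: mat_power_cdiag assms cdiag_scaleR cdiag_nth divide_inverse_commute)
  qed
  then show ?thesis
    unfolding mat_exp_def by (rule sums_unique[symmetric])
qed

text \<open>Fixed rank-one matrices with scalar coefficients: differentiation then acts on the
  coefficients only.\<close>

lemma cdiag_as_sum: "cdiag g d = (\<Sum>k\<in>UNIV. d k *\<^sub>R (\<chi> i j. g $ i $ k * g $ j $ k))"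
  by (simp add: vec_eq_iff cdiag_nth sum_component)

lemma cdiag_exp_has_vector_derivative:
  "((\<lambda>t. cdiag g (\<lambda>i. exp (t * d i))) has_vector_derivative cdiag g d) (at 0 within S)"
proof -
  have "((\<lambda>t. exp (t * c) *\<^sub>R M) has_vector_derivative c *\<^sub>R M) (at 0 within S)"
    for c and M :: "real^'m^'m"
  proof -
    have "((\<lambda>t. exp (t * c)) has_real_derivative c) (at 0 within S)"
      by (auto intro!: derivative_eq_intros)
    then show ?thesis
      using has_vector_derivative_scaleR[of "\<lambda>t. exp (t * c)" c 0 S "\<lambda>_. M" 0] by simp
  qed
  then show ?thesis
    unfolding cdiag_as_sum by (intro has_vector_derivative_sum)
qed

section \<open>The Loewner order\<close>

definition loewner_le :: "real^'m^'m \<Rightarrow> real^'m^'m \<Rightarrow> bool" where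
  "loewner_le A B \<longleftrightarrow> (\<forall>u. u \<bullet> (A *v u) \<le> u \<bullet> (B *v u))"

lemma loewner_le_trans: "loewner_le A B \<Longrightarrow> loewner_le B C \<Longrightarrow> loewner_le A C"
  unfolding loewner_le_def by (meson order_trans)

lemma loewner_le_scaleR: "0 \<le> c \<Longrightarrow> loewner_le A B \<Longrightarrow> loewner_le (c *\<^sub>R A) (c *\<^sub>R B)"
  by (simp add: loewner_le_def scaleR_matrix_vector_assoc[symmetric] mult_left_mono)

lemma loewner_le_scaleR_mono: "A \<in> pd_mats \<Longrightarrow> a \<le> b \<Longrightarrow> loewner_le (a *\<^sub>R A) (b *\<^sub>R A)"
  by (simp add: loewner_le_def scaleR_matrix_vector_assoc[symmetric] mult_right_mono pd_mats_nonneg)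

lemma loewner_le_congruence:
  assumes "loewner_le A B"
  shows "loewner_le (g ** A ** transpose g) (g ** B ** transpose g)"
proof -
  have "u \<bullet> ((g ** X ** transpose g) *v u) = (transpose g *v u) \<bullet> (X *v (transpose g *v u))" for u X
    by (simp only: matrix_vector_mul_assoc[symmetric] dot_matrix_vector_transpose)
  then show ?thesis
    using assms by (simp add: loewner_le_def del: transpose_matrix_vector)
qed

text \<open>Column \<open>k\<close> of the common factor \<open>U\<close> is a test vector that
  picks out the coefficient with index \<open>k\<close>.\<close>

lemma loewner_le_cdiag:
  assumes "orthogonal_matrix U"
  shows "loewner_le (cdiag U a) (cdiag U b) \<longleftrightarrow> (\<forall>i. a i \<le> b i)"
proof
  assume le: "loewner_le (cdiag U a) (cdiag U b)"
  show "\<forall>i. a i \<le> b i"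
  proof
    fix k
    define u where "u = U *v axis k 1"
    have w: "transpose U *v u = axis k 1"
      using assms by (simp add: u_def matrix_vector_mul_assoc orthogonal_matrix_def del: transpose_matrix_vector)
    have "u \<bullet> (cdiag U d *v u) = d k" for d
    proof -
      have "u \<bullet> (cdiag U d *v u) = (\<Sum>i\<in>UNIV. if i = k then d i else 0)"
        unfolding inner_cdiag w by (rule sum.cong) (auto simp: axis_def)
      then show ?thesis
        by simp
    qed
    then show "a k \<le> b k"
      using le unfolding loewner_le_def by metis
  qed
next
  assume "\<forall>i. a i \<le> b i"
  then show "loewner_le (cdiag U a) (cdiag U b)"
    by (simp add: loewner_le_def inner_cdiag sum_mono mult_right_mono del: transpose_matrix_vector)
qed

text \<open>The order sees only the symmetric part of a matrix, hence the two symmetry hypotheses. A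
  symmetric difference with vanishing quadratic form has only zero eigenvalues.\<close>

lemma loewner_le_antisym:
  assumes "loewner_le A B" "loewner_le B A" "A \<in> sym_mats" "B \<in> sym_mats"
  shows "A = B"
proof -
  have "A - B \<in> sym_mats"
    using assms by (simp add: sym_mats_def transpose_diff)
  then obtain U d where U: "orthogonal_matrix U" "A - B = cdiag U d"
    using spectral_theorem by blast
  have zero: "cdiag U (\<lambda>_. 0) = 0"
    by (simp add: vec_eq_iff cdiag_nth)
  have "u \<bullet> ((A - B) *v u) = 0" for u
    using assms(1,2) by (simp add: loewner_le_def matrix_vector_mult_diff_rdistrib inner_diff_right antisym)
  then have "loewner_le (cdiag U d) (cdiag U (\<lambda>_. 0))" "loewner_le (cdiag U (\<lambda>_. 0)) (cdiag U d)"
    by (simp_all add: loewner_le_def zero U(2))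
  then have "d = (\<lambda>_. 0)"
    by (simp add: loewner_le_cdiag[OF U(1)] antisym fun_eq_iff)
  then show ?thesis
    using U(2) zero by simp
qed

text \<open>If \<open>B - A\<close> had an eigenvector \<open>u\<close> with a negative eigenvalue,
  then \<open>A *v u\<close> would be \<open>B *v u\<close> plus a positive multiple of
  \<open>u\<close>. As \<open>u \<bullet> (B *v u)\<close> is nonnegative, \<open>A *v u\<close>
  would be strictly longer than \<open>B *v u\<close>, against the hypothesis on the
  squares.\<close>

lemma loewner_le_square_root:
  assumes A: "A \<in> pd_mats" and B: "B \<in> pd_mats" and le: "loewner_le (A ** A) (B ** B)"
  shows "loewner_le A B"
proof -
  have "B - A \<in> sym_mats"
    using A B by (simp add: pd_mats_def sym_mats_def transpose_diff)
  then obtain U d where U: "orthogonal_matrix U" "B - A = cdiag U d"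
    using spectral_theorem by blast
  have "0 \<le> d k" for k
  proof (rule ccontr)
    assume neg: "\<not> 0 \<le> d k"
    define u where "u = U *v axis k 1"
    have "(B - A) *v u = (U ** diag d ** (transpose U ** U)) *v axis k 1"
      by (simp add: U(2) u_def cdiag_def matrix_vector_mul_assoc matrix_mul_assoc)
    also have "\<dots> = U *v (diag d *v axis k 1)"
      using U(1) by (simp add: orthogonal_matrix_def matrix_vector_mul_assoc)
    also have "diag d *v axis k 1 = d k *\<^sub>R axis k 1"
      by (auto simp: vec_eq_iff diag_mult_vector_nth axis_def)
    finally have Au: "A *v u = B *v u - d k *\<^sub>R u"
      by (simp add: u_def matrix_vector_mult_diff_rdistrib matrix_vector_mult_scaleR algebra_simps)
    have "u \<noteq> 0"
      using invertible_mult_eq_0[OF orthogonal_matrix_invertible[OF U(1)]] by (simp add: u_def axis_eq_0_iff)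
    have sq: "u \<bullet> ((X ** X) *v u) = (X *v u) \<bullet> (X *v u)" if "X \<in> pd_mats" for X
      using pd_mats_transpose[OF that]
      by (simp only: matrix_vector_mul_assoc[symmetric] dot_matrix_vector_transpose)
    have "(A *v u) \<bullet> (A *v u) \<le> (B *v u) \<bullet> (B *v u)"
      using le A B by (simp add: loewner_le_def sq[symmetric])
    moreover have "(A *v u) \<bullet> (A *v u)
        = (B *v u) \<bullet> (B *v u) + 2 * (- d k) * (u \<bullet> (B *v u)) + (d k)\<^sup>2 * (u \<bullet> u)"
      by (simp add: Au inner_simps inner_commute[of u "B *v u"] algebra_simps power2_eq_square)
    moreover have "0 \<le> 2 * (- d k) * (u \<bullet> (B *v u))"
      using neg pd_mats_nonneg[OF B, of u] by (intro mult_nonneg_nonneg) auto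
    moreover have "0 < (d k)\<^sup>2 * (u \<bullet> u)"
      using neg \<open>u \<noteq> 0\<close> by simp
    ultimately show False
      by linarith
  qed
  then have "0 \<le> u \<bullet> ((B - A) *v u)" for u
    unfolding U(2) inner_cdiag by (simp add: sum_nonneg)
  then show ?thesis
    by (simp add: loewner_le_def matrix_vector_mult_diff_rdistrib inner_diff_right)
qed

text \<open>Iterating \<open>loewner_le_square_root\<close> gives the hypothesis with \<open>a, b\<close> scaled by
  \<open>2\<^sup>-\<^sup>n\<close>; in the limit the exponentials linearise. So the logarithm is operator monotone.\<close>

lemma loewner_le_exp_imp:
  assumes U: "orthogonal_matrix U" and V: "orthogonal_matrix V"
    and le: "loewner_le (cdiag U (\<lambda>i. exp (a i))) (cdiag V (\<lambda>i. exp (b i)))"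
  shows "loewner_le (cdiag U a) (cdiag V b)"
proof -
  define t :: "nat \<Rightarrow> real" where "t n = (1/2)^n" for n
  have roots: "loewner_le (cdiag U (\<lambda>i. exp (t n * a i))) (cdiag V (\<lambda>i. exp (t n * b i)))" for n
  proof (induction n)
    case 0
    then show ?case
      using le by (simp add: t_def)
  next
    case (Suc n)
    have "exp (t (Suc n) * c) * exp (t (Suc n) * c) = exp (t n * c)" for c
      by (simp add: t_def mult_exp_exp)
    then have "loewner_le (cdiag U (\<lambda>i. exp (t (Suc n) * a i)) ** cdiag U (\<lambda>i. exp (t (Suc n) * a i)))
        (cdiag V (\<lambda>i. exp (t (Suc n) * b i)) ** cdiag V (\<lambda>i. exp (t (Suc n) * b i)))"
      using Suc U V by (simp add: cdiag_mult)
    then show ?case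
      by (rule loewner_le_square_root[rotated 2])
         (use U V in \<open>auto intro!: cdiag_in_pd_mats orthogonal_matrix_invertible\<close>)
  qed
  show ?thesis
    unfolding loewner_le_def
  proof
    fix u
    define p where "p i = ((transpose U *v u) $ i)\<^sup>2" for i
    define q where "q i = ((transpose V *v u) $ i)\<^sup>2" for i
    \<comment> \<open>The gap between the two quadratic forms at \<open>u\<close> for the exponent
      \<open>s\<close>. It vanishes at 0, where both matrices are the identity, and its derivative
      there is the difference to be shown nonnegative.\<close>
    define f where "f s = (\<Sum>i\<in>UNIV. exp (s * b i) * q i) - (\<Sum>i\<in>UNIV. exp (s * a i) * p i)" for s
    have "(f has_real_derivative ((\<Sum>i\<in>UNIV. b i * q i) - (\<Sum>i\<in>UNIV. a i * p i))) (at 0)"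
      unfolding f_def by (auto intro!: derivative_eq_intros)
    moreover have "f 0 = 0"
    proof -
      have "u \<bullet> (cdiag U (\<lambda>_. 1) *v u) = u \<bullet> (cdiag V (\<lambda>_. 1) *v u)"
        using U V by (simp add: cdiag_one orthogonal_matrix_def)
      then show ?thesis
        by (simp only: inner_cdiag f_def p_def q_def) simp
    qed
    ultimately have "((\<lambda>h. f h / h) \<longlongrightarrow> (\<Sum>i\<in>UNIV. b i * q i) - (\<Sum>i\<in>UNIV. a i * p i)) (at 0)"
      by (simp add: DERIV_def)
    moreover have "filterlim t (at 0) sequentially"
      unfolding t_def filterlim_at by (auto intro: LIMSEQ_realpow_zero)
    ultimately have "(\<lambda>n. f (t n) / t n) \<longlonglongrightarrow> (\<Sum>i\<in>UNIV. b i * q i) - (\<Sum>i\<in>UNIV. a i * p i)"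
      by (rule filterlim_compose)
    moreover have "0 \<le> f (t n) / t n" for n
      using roots[of n] unfolding loewner_le_def inner_cdiag
      by (simp add: f_def p_def q_def t_def del: transpose_matrix_vector)
    ultimately have "0 \<le> (\<Sum>i\<in>UNIV. b i * q i) - (\<Sum>i\<in>UNIV. a i * p i)"
      by (intro LIMSEQ_le_const) auto
    then show "u \<bullet> (cdiag U a *v u) \<le> u \<bullet> (cdiag V b *v u)"
      unfolding inner_cdiag p_def q_def by simp
  qed
qed

text \<open>The logarithm turns \<open>c\<close> into the additive term
  \<open>ln c * (u \<bullet> u)\<close>, which is constant in \<open>t\<close>, whereas the two
  forms grow linearly in \<open>t\<close>.\<close>

lemma loewner_le_if_exp_dominated:
  assumes U: "orthogonal_matrix U" and V: "orthogonal_matrix V" and "0 < c"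
    and le: "\<And>t. 0 \<le> t \<Longrightarrow>
      loewner_le (cdiag U (\<lambda>i. exp (t * a i))) (c *\<^sub>R cdiag V (\<lambda>i. exp (t * b i)))"
  shows "loewner_le (cdiag U a) (cdiag V b)"
  unfolding loewner_le_def
proof
  fix u
  define A where "A = u \<bullet> (cdiag U a *v u)"
  define B where "B = u \<bullet> (cdiag V b *v u)"
  have bound: "t * A \<le> t * B + ln c * (u \<bullet> u)" if "0 \<le> t" for t
  proof -
    have "c *\<^sub>R cdiag V (\<lambda>i. exp (t * b i)) = cdiag V (\<lambda>i. exp (t * b i + ln c))"
      using \<open>0 < c\<close> by (simp add: cdiag_scaleR exp_add mult.commute)
    then have "loewner_le (cdiag U (\<lambda>i. exp (t * a i))) (cdiag V (\<lambda>i. exp (t * b i + ln c)))"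
      using le[OF that] by simp
    then have "loewner_le (cdiag U (\<lambda>i. t * a i)) (cdiag V (\<lambda>i. t * b i + ln c))"
      by (rule loewner_le_exp_imp[OF U V])
    then have "u \<bullet> (cdiag U (\<lambda>i. t * a i) *v u) \<le> u \<bullet> (cdiag V (\<lambda>i. t * b i + ln c) *v u)"
      by (simp add: loewner_le_def)
    moreover have "cdiag V (\<lambda>i. t * b i + ln c) = t *\<^sub>R cdiag V b + ln c *\<^sub>R mat 1"
    proof -
      have "mat 1 = cdiag V (\<lambda>_. 1)"
        using V by (simp add: cdiag_one orthogonal_matrix_def)
      then show ?thesis
        by (simp only: vec_eq_iff cdiag_nth vector_add_component vector_scaleR_component)
           (simp add: sum_distrib_left algebra_simps sum.distrib)
    qed
    ultimately show ?thesis
      by (simp add: A_def B_def cdiag_scaleR[symmetric] matrix_vector_mult_add_rdistrib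
          scaleR_matrix_vector_assoc[symmetric] inner_add_right)
  qed
  show "A \<le> B"
  proof (rule ccontr)
    assume "\<not> A \<le> B"
    \<comment> \<open>Chosen so that \<open>t * (A - B)\<close> exceeds the constant term by
      1.\<close>
    define t where "t = (\<bar>ln c * (u \<bullet> u)\<bar> + 1) / (A - B)"
    have "t * (A - B) = \<bar>ln c * (u \<bullet> u)\<bar> + 1" "0 \<le> t"
      using \<open>\<not> A \<le> B\<close> by (simp_all add: t_def)
    with bound[of t] show False
      by (simp add: algebra_simps)
  qed
qed

section \<open>Square roots, logarithms and the trace metric\<close>

text \<open>Uniqueness, without which \<open>THE\<close> says nothing, follows from monotonicity:
  two positive definite roots of the same matrix lie below each other in the Loewner order.\<close>

lemma mat_sqrt_in_pd_mats: "mat_sqrt x \<in> pd_mats"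
  and mat_sqrt_square: "mat_sqrt x ** mat_sqrt x = x" if x: "x \<in> pd_mats"
proof -
  obtain U d where U: "orthogonal_matrix U" "x = cdiag U d" "\<And>i. 0 < d i"
    using x pd_mats_spectral by blast
  have "\<exists>!B. B \<in> pd_mats \<and> B ** B = x"
  proof (rule ex_ex1I)
    show "\<exists>B. B \<in> pd_mats \<and> B ** B = x"
      using U by (intro exI[of _ "cdiag U (\<lambda>i. sqrt (d i))"])
        (auto simp: cdiag_mult less_imp_le intro!: cdiag_in_pd_mats orthogonal_matrix_invertible)
  next
    fix A B
    assume *: "A \<in> pd_mats \<and> A ** A = x" "B \<in> pd_mats \<and> B ** B = x"
    then have "loewner_le (A ** A) (B ** B)" "loewner_le (B ** B) (A ** A)"
      by (simp_all add: loewner_le_def)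
    with * show "A = B"
      by (intro loewner_le_antisym) (auto intro: loewner_le_square_root simp: pd_mats_def)
  qed
  from theI'[OF this] show "mat_sqrt x \<in> pd_mats" "mat_sqrt x ** mat_sqrt x = x"
    by (simp_all add: mat_sqrt_def)
qed

text \<open>As for the square root, monotonicity gives uniqueness: two symmetric matrices with equal
  exponentials lie below each other.\<close>

lemma mat_log_cdiag:
  assumes "orthogonal_matrix U" "\<And>i. 0 < d i"
  shows "mat_log (cdiag U d) = cdiag U (\<lambda>i. ln (d i))"
  unfolding mat_log_def
proof (rule the_equality)
  show "cdiag U (\<lambda>i. ln (d i)) \<in> sym_mats \<and> mat_exp (cdiag U (\<lambda>i. ln (d i))) = cdiag U d"
    using assms by (simp add: cdiag_in_sym_mats mat_exp_cdiag)
next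
  fix B
  assume B: "B \<in> sym_mats \<and> mat_exp B = cdiag U d"
  then obtain V b where V: "orthogonal_matrix V" "B = cdiag V b"
    using spectral_theorem by blast
  have "cdiag V (\<lambda>i. exp (b i)) = cdiag U (\<lambda>i. exp (ln (d i)))"
    using B V assms by (simp add: mat_exp_cdiag)
  then show "B = cdiag U (\<lambda>i. ln (d i))"
    unfolding V(2) using V(1) assms(1)
    by (intro loewner_le_antisym cdiag_in_sym_mats) (rule loewner_le_exp_imp; simp add: loewner_le_def)+
qed

lemma
  assumes x: "x \<in> pd_mats"
  shows mat_inv_sqrt_mult: "mat_inv_sqrt x ** mat_sqrt x = mat 1"
    and mat_sqrt_mult_inv: "mat_sqrt x ** mat_inv_sqrt x = mat 1"
    and transpose_mat_inv_sqrt: "transpose (mat_inv_sqrt x) = mat_inv_sqrt x"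
    and mat_inv_sqrt_square: "mat_inv_sqrt x ** mat_inv_sqrt x = matrix_inv x"
    and mat_inv_sqrt_conj: "mat_inv_sqrt x ** x ** mat_inv_sqrt x = mat 1"
proof -
  let ?S = "mat_sqrt x" and ?R = "mat_inv_sqrt x"
  have inv: "invertible ?S"
    by (simp add: pd_mats_invertible mat_sqrt_in_pd_mats x)
  show RS: "?R ** ?S = mat 1" and SR: "?S ** ?R = mat 1"
    by (simp_all add: mat_inv_sqrt_def inv matrix_mul_inv_left matrix_mul_inv_right)
  have "?S ** transpose ?R = transpose (?R ** ?S)"
    by (simp add: matrix_transpose_mul pd_mats_transpose mat_sqrt_in_pd_mats x)
  then have "?S ** transpose ?R = mat 1"
    by (simp add: RS)
  then show "transpose ?R = ?R"
    using matrix_inv_eqI by (metis mat_inv_sqrt_def)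
  have "x ** (?R ** ?R) = ?S ** (?S ** ?R) ** ?R"
    by (simp add: matrix_mul_assoc mat_sqrt_square x)
  then show "?R ** ?R = matrix_inv x"
    by (simp add: SR matrix_inv_eqI)
  have "?R ** x ** ?R = (?R ** ?S) ** (?S ** ?R)"
    by (metis matrix_mul_assoc mat_sqrt_square x)
  then show "?R ** x ** ?R = mat 1"
    by (simp add: SR RS)
qed

text \<open>Since \<open>x = g ** transpose g\<close>, the matrix
  \<open>k = mat_inv_sqrt x ** g\<close> is orthogonal. So conjugation by
  \<open>mat_inv_sqrt x\<close> turns \<open>cdiag g d\<close> into the spectral decomposition
  \<open>cdiag k d\<close>, on which exponential and trace act through \<open>d\<close> alone;
  conjugation by \<open>mat_sqrt x\<close> turns \<open>k\<close> back into
  \<open>g\<close>.\<close>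

lemma
  fixes g :: "real^'m^'m"
  assumes "invertible g"
  shows riem_exp_cdiag: "riem_exp (g ** transpose g) (t *\<^sub>R cdiag g d) = cdiag g (\<lambda>i. exp (t * d i))"
    and trace_metric_cdiag: "trace_metric (g ** transpose g) (cdiag g d) (cdiag g d) = (\<Sum>i\<in>UNIV. (d i)\<^sup>2)"
proof -
  define x where "x = g ** transpose g"
  have x: "x \<in> pd_mats"
    unfolding x_def cdiag_one[symmetric] using assms by (rule cdiag_in_pd_mats) simp
  let ?S = "mat_sqrt x" and ?R = "mat_inv_sqrt x"
  define k where "k = ?R ** g"
  have "k ** transpose k = ?R ** x ** ?R"
    by (simp add: k_def x_def matrix_transpose_mul matrix_mul_assoc transpose_mat_inv_sqrt[OF x, unfolded x_def])
  then have k: "orthogonal_matrix k"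
    unfolding orthogonal_matrix by (metis mat_inv_sqrt_conj x matrix_left_right_inverse)
  have R: "?R ** cdiag g a ** ?R = cdiag k a" for a
    using cdiag_congruence[of ?R g a] by (simp add: transpose_mat_inv_sqrt x k_def)
  have "?S ** k = g"
    by (simp add: k_def matrix_mul_assoc mat_sqrt_mult_inv x)
  then have S: "?S ** cdiag k a ** ?S = cdiag g a" for a
    using cdiag_congruence[of ?S k a] by (simp add: pd_mats_transpose mat_sqrt_in_pd_mats x)
  show "riem_exp x (t *\<^sub>R cdiag g d) = cdiag g (\<lambda>i. exp (t * d i))"
    by (simp add: riem_exp_def cdiag_scaleR R mat_exp_cdiag k S)
  have "trace_metric x (cdiag g d) (cdiag g d) = trace (?R ** (?R ** cdiag g d ** ?R ** ?R ** cdiag g d))"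
    by (simp add: trace_metric_def mat_inv_sqrt_square[OF x, symmetric] matrix_mul_assoc)
  also have "\<dots> = trace (?R ** cdiag g d ** ?R ** ?R ** cdiag g d ** ?R)"
    by (rule trace_mul_sym)
  also have "\<dots> = trace ((?R ** cdiag g d ** ?R) ** (?R ** cdiag g d ** ?R))"
    by (simp add: matrix_mul_assoc)
  also have "\<dots> = (\<Sum>i\<in>UNIV. (d i)\<^sup>2)"
    by (simp add: R cdiag_mult trace_cdiag k power2_eq_square)
  finally show "trace_metric x (cdiag g d) (cdiag g d) = (\<Sum>i\<in>UNIV. (d i)\<^sup>2)" .
qed

text \<open>Simultaneous diagonalisation by congruence: after \<open>x\<close> has been moved to the
  identity by \<open>mat_inv_sqrt x\<close>, an orthogonal matrix diagonalises what has become of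
  \<open>v\<close>.\<close>

lemma tangent_vector_as_cdiag:
  assumes x: "x \<in> pd_mats" and v: "v \<in> sym_mats"
  obtains g d where "invertible g" "x = g ** transpose g" "v = cdiag g d"
proof -
  let ?S = "mat_sqrt x" and ?R = "mat_inv_sqrt x"
  have "?R ** v ** ?R \<in> sym_mats"
    using v by (simp add: sym_mats_def matrix_transpose_mul transpose_mat_inv_sqrt x matrix_mul_assoc)
  then obtain U d where U: "orthogonal_matrix U" "?R ** v ** ?R = cdiag U d"
    using spectral_theorem by blast
  define g where "g = ?S ** U"
  have tS: "transpose ?S = ?S"
    by (simp add: pd_mats_transpose mat_sqrt_in_pd_mats x)
  have "cdiag g d = ?S ** (?R ** v ** ?R) ** ?S"
    using cdiag_congruence[of ?S U d] by (simp add: U g_def tS)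
  also have "\<dots> = (?S ** ?R) ** v ** (?R ** ?S)"
    by (simp only: matrix_mul_assoc)
  finally have "v = cdiag g d"
    by (simp add: mat_sqrt_mult_inv mat_inv_sqrt_mult x)
  moreover have "g ** transpose g = ?S ** (U ** transpose U) ** ?S"
    by (simp add: g_def matrix_transpose_mul tS matrix_mul_assoc)
  then have "x = g ** transpose g"
    using U(1) by (simp add: orthogonal_matrix_def mat_sqrt_square x)
  moreover have "invertible g"
    unfolding g_def
    by (intro invertible_mult pd_mats_invertible mat_sqrt_in_pd_mats x orthogonal_matrix_invertible U)
  ultimately show thesis
    using that by blast
qed

text \<open>Normal form of a ray: origin \<open>g ** transpose g\<close>, initial velocity
  \<open>cdiag g d\<close>, unit speed as a condition on \<open>d\<close> alone.\<close>

lemma unit_rays_iff: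
  "\<gamma> \<in> unit_rays \<longleftrightarrow>
    (\<exists>g d. invertible g \<and> (\<Sum>i\<in>UNIV. (d i)\<^sup>2) = 1 \<and> \<gamma> = (\<lambda>t\<in>{0..}. cdiag g (\<lambda>i. exp (t * d i))))"
  (is "?L \<longleftrightarrow> ?R")
proof
  assume ?L
  then obtain x v where x: "x \<in> pd_mats" and v: "v \<in> sym_mats" "trace_metric x v v = 1"
    and \<gamma>: "\<gamma> = (\<lambda>t\<in>{0..}. riem_exp x (t *\<^sub>R v))"
    by (auto simp: unit_rays_def)
  obtain g d where g: "invertible g" "x = g ** transpose g" "v = cdiag g d"
    using tangent_vector_as_cdiag[OF x v(1)] by blast
  show ?R
    using v(2) by (intro exI[of _ g] exI[of _ d]) (simp add: \<gamma> g riem_exp_cdiag trace_metric_cdiag)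
next
  assume ?R
  then obtain g d where g: "invertible g" "(\<Sum>i\<in>UNIV. (d i)\<^sup>2) = 1"
    "\<gamma> = (\<lambda>t\<in>{0..}. cdiag g (\<lambda>i. exp (t * d i)))"
    by blast
  have "g ** transpose g \<in> pd_mats"
    unfolding cdiag_one[symmetric] by (rule cdiag_in_pd_mats) (simp_all add: g)
  then show ?L
    unfolding unit_rays_def
    by (intro CollectI bexI[of _ "g ** transpose g"] bexI[of _ "cdiag g d"])
       (simp_all add: g riem_exp_cdiag trace_metric_cdiag cdiag_in_sym_mats)
qed

section \<open>Asymptotic rays\<close>

lemma frobenius_norm_cdiag:
  assumes "orthogonal_matrix U"
  shows "frobenius_norm (cdiag U d) = sqrt (\<Sum>i\<in>UNIV. (d i)\<^sup>2)"
proof -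
  have "(\<Sum>i\<in>UNIV. \<Sum>j\<in>UNIV. (cdiag U d $ i $ j)\<^sup>2) = trace (cdiag U d ** transpose (cdiag U d))"
    unfolding trace_def matrix_matrix_mult_def transpose_def by (simp add: power2_eq_square)
  also have "\<dots> = (\<Sum>i\<in>UNIV. (d i)\<^sup>2)"
    by (simp add: cdiag_mult trace_cdiag assms power2_eq_square)
  finally show ?thesis
    by (simp add: frobenius_norm_def)
qed

text \<open>With \<open>d\<close> the eigenvalues of \<open>p\<close> relative to \<open>x\<close>,
  the distance is the Euclidean norm of the numbers \<open>ln (d i)\<close>, while mutual domination
  with constant \<open>c\<close> says that every \<open>d i\<close> lies between
  \<open>1 / c\<close> and \<open>c\<close>. The factor \<open>CARD('m)\<close> comes from comparing
  the Euclidean with the maximum norm.\<close>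

lemma
  assumes x: "(x :: real^'m^'m) \<in> pd_mats" and p: "p \<in> pd_mats"
  shows riem_dist_le_imp_loewner_le:
      "riem_dist x p \<le> C \<Longrightarrow> loewner_le p (exp C *\<^sub>R x) \<and> loewner_le x (exp C *\<^sub>R p)"
    and riem_dist_le_if_loewner_le:
      "0 < c \<Longrightarrow> loewner_le p (c *\<^sub>R x) \<Longrightarrow> loewner_le x (c *\<^sub>R p) \<Longrightarrow>
        riem_dist x p \<le> sqrt (CARD('m) * (ln c)\<^sup>2)"
proof -
  let ?S = "mat_sqrt x" and ?R = "mat_inv_sqrt x"
  have tS: "transpose ?S = ?S" and tR: "transpose ?R = ?R"
    by (simp_all add: pd_mats_transpose mat_sqrt_in_pd_mats transpose_mat_inv_sqrt x)
  have "invertible ?R"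
    using mat_inv_sqrt_mult[OF x] invertible_right_inverse by blast
  with p have "?R ** p ** ?R \<in> pd_mats"
    using congruence_in_pd_mats[of p ?R] tR by simp
  then obtain U d where U: "orthogonal_matrix U" "?R ** p ** ?R = cdiag U d" "\<And>i. 0 < d i"
    using pd_mats_spectral by blast
  have dist: "riem_dist x p = sqrt (\<Sum>i\<in>UNIV. (ln (d i))\<^sup>2)"
    by (simp add: riem_dist_def U mat_log_cdiag frobenius_norm_cdiag)
  have one: "?R ** x ** ?R = cdiag U (\<lambda>_. 1)"
    using U(1) by (simp add: mat_inv_sqrt_conj x cdiag_one orthogonal_matrix_def)
  have undo: "?S ** (?R ** X ** ?R) ** ?S = X" for X
  proof -
    have "?S ** (?R ** X ** ?R) ** ?S = (?S ** ?R) ** X ** (?R ** ?S)"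
      by (simp only: matrix_mul_assoc)
    then show ?thesis
      by (simp add: mat_sqrt_mult_inv mat_inv_sqrt_mult x)
  qed
  have conj: "loewner_le X Y \<longleftrightarrow> loewner_le (?R ** X ** ?R) (?R ** Y ** ?R)" for X Y
    using loewner_le_congruence[of X Y ?R] loewner_le_congruence[of "?R ** X ** ?R" "?R ** Y ** ?R" ?S]
    unfolding tS tR undo by blast
  have scale: "?R ** (c *\<^sub>R X) ** ?R = c *\<^sub>R (?R ** X ** ?R)" for c X
    by (simp add: matrix_scalar_ac scalar_matrix_assoc[symmetric])
  have iff: "loewner_le p (c *\<^sub>R x) \<longleftrightarrow> (\<forall>i. d i \<le> c)" "loewner_le x (c *\<^sub>R p) \<longleftrightarrow> (\<forall>i. 1 \<le> c * d i)" for c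
    unfolding conj[of p] conj[of x] scale one U(2) cdiag_scaleR loewner_le_cdiag[OF U(1)] by simp_all
  {
    assume le: "riem_dist x p \<le> C"
    have "\<bar>ln (d i)\<bar> \<le> C" for i
    proof -
      have "(ln (d i))\<^sup>2 \<le> (\<Sum>i\<in>UNIV. (ln (d i))\<^sup>2)"
        by (rule member_le_sum) auto
      then have "sqrt ((ln (d i))\<^sup>2) \<le> riem_dist x p"
        unfolding dist by (rule real_sqrt_le_mono)
      then show ?thesis
        using le by simp
    qed
    then have "ln (d i) \<le> C" "- C \<le> ln (d i)" for i
      using abs_le_iff[of "ln (d i)" C] minus_le_iff[of "ln (d i)" C] by blast+
    then have "d i \<le> exp C" "exp (- C) \<le> d i" for i
      using U(3)[of i] by (metis exp_le_cancel_iff exp_ln)+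
    then show "loewner_le p (exp C *\<^sub>R x) \<and> loewner_le x (exp C *\<^sub>R p)"
      unfolding iff by (auto simp: exp_minus field_simps)
  }
  {
    assume c: "0 < c" and le: "loewner_le p (c *\<^sub>R x)" "loewner_le x (c *\<^sub>R p)"
    have "(ln (d i))\<^sup>2 \<le> (ln c)\<^sup>2" for i
    proof -
      have "ln (d i) \<le> ln c"
        using le U(3)[of i] c by (simp add: iff)
      moreover have "ln 1 \<le> ln (c * d i)"
        using le U(3)[of i] c unfolding iff by (subst ln_le_cancel_iff) auto
      then have "- ln c \<le> ln (d i)"
        using c U(3)[of i] by (simp add: ln_mult)
      ultimately show ?thesis
        by (simp add: abs_le_square_iff[symmetric])
    qed
    then have "(\<Sum>i\<in>UNIV. (ln (d i))\<^sup>2) \<le> (\<Sum>i\<in>(UNIV :: 'm set). (ln c)\<^sup>2)"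
      by (rule sum_mono)
    then show "riem_dist x p \<le> sqrt (CARD('m) * (ln c)\<^sup>2)"
      unfolding dist by simp
  }
qed

lemma bounded_riem_dist_iff:
  fixes \<alpha> \<beta> :: "real \<Rightarrow> real^'m^'m"
  assumes "\<And>t. 0 \<le> t \<Longrightarrow> \<alpha> t \<in> pd_mats" "\<And>t. 0 \<le> t \<Longrightarrow> \<beta> t \<in> pd_mats"
  shows "bounded ((\<lambda>t. riem_dist (\<alpha> t) (\<beta> t)) ` {0..}) \<longleftrightarrow>
    (\<exists>c>0. \<forall>t\<ge>0. loewner_le (\<beta> t) (c *\<^sub>R \<alpha> t) \<and> loewner_le (\<alpha> t) (c *\<^sub>R \<beta> t))" (is "?L \<longleftrightarrow> ?R")
proof
  assume ?L
  then obtain C where "\<And>t. 0 \<le> t \<Longrightarrow> \<bar>riem_dist (\<alpha> t) (\<beta> t)\<bar> \<le> C"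
    by (auto simp: bounded_iff)
  then have "loewner_le (\<beta> t) (exp C *\<^sub>R \<alpha> t) \<and> loewner_le (\<alpha> t) (exp C *\<^sub>R \<beta> t)" if "0 \<le> t" for t
    using that assms by (intro riem_dist_le_imp_loewner_le) (auto simp: abs_le_iff)
  then show ?R
    by (intro exI[of _ "exp C"]) simp
next
  assume ?R
  then obtain c where c: "0 < c"
    "\<And>t. 0 \<le> t \<Longrightarrow> loewner_le (\<beta> t) (c *\<^sub>R \<alpha> t) \<and> loewner_le (\<alpha> t) (c *\<^sub>R \<beta> t)"
    by blast
  have "\<bar>riem_dist (\<alpha> t) (\<beta> t)\<bar> \<le> sqrt (CARD('m) * (ln c)\<^sup>2)" if "0 \<le> t" for t
  proof -
    have "0 \<le> riem_dist (\<alpha> t) (\<beta> t)"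
      by (simp add: riem_dist_def frobenius_norm_def sum_nonneg)
    then show ?thesis
      using riem_dist_le_if_loewner_le[of "\<alpha> t" "\<beta> t" c] assms c that by simp
  qed
  then show ?L
    by (auto simp: bounded_iff)
qed

lemma unit_ray_in_pd_mats:
  assumes "\<gamma> \<in> unit_rays" "0 \<le> t"
  shows "\<gamma> t \<in> pd_mats"
  using assms by (auto simp: unit_rays_iff intro!: cdiag_in_pd_mats)

lemma asymptotic_rays_iff:
  "(\<gamma>, \<gamma>') \<in> asymptotic_rays \<longleftrightarrow> \<gamma> \<in> unit_rays \<and> \<gamma>' \<in> unit_rays \<and>
    (\<exists>c>0. \<forall>t\<ge>0. loewner_le (\<gamma>' t) (c *\<^sub>R \<gamma> t) \<and> loewner_le (\<gamma> t) (c *\<^sub>R \<gamma>' t))"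
  unfolding asymptotic_rays_def
  using bounded_riem_dist_iff[of \<gamma> \<gamma>'] unit_ray_in_pd_mats by auto

text \<open>Both rays are compared with \<alpha> because a boundary point is given as the class of
  one ray; chaining the dominations yields the constant \<open>b * c\<close>. Congruence by the
  inverse of \<open>g\<close> moves the common origin to the identity, where both factors become
  orthogonal and \<open>loewner_le_if_exp_dominated\<close> applies in each direction.\<close>

lemma asymptotic_rays_unique:
  assumes "(\<alpha>, \<beta>) \<in> asymptotic_rays" "(\<alpha>, \<gamma>) \<in> asymptotic_rays" and start: "\<beta> 0 = \<gamma> 0"
  shows "\<beta> = \<gamma>"
proof -
  obtain b where b: "b > 0" "\<And>t. 0 \<le> t \<Longrightarrow> loewner_le (\<beta> t) (b *\<^sub>R \<alpha> t) \<and> loewner_le (\<alpha> t) (b *\<^sub>R \<beta> t)"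
    using assms(1) unfolding asymptotic_rays_iff by blast
  obtain c where c: "c > 0" "\<And>t. 0 \<le> t \<Longrightarrow> loewner_le (\<gamma> t) (c *\<^sub>R \<alpha> t) \<and> loewner_le (\<alpha> t) (c *\<^sub>R \<gamma> t)"
    using assms(2) unfolding asymptotic_rays_iff by blast
  have le: "loewner_le (\<beta> t) ((b * c) *\<^sub>R \<gamma> t)" "loewner_le (\<gamma> t) ((b * c) *\<^sub>R \<beta> t)" if "0 \<le> t" for t
    using loewner_le_trans loewner_le_scaleR[of b "\<alpha> t" "c *\<^sub>R \<gamma> t"]
      loewner_le_scaleR[of c "\<alpha> t" "b *\<^sub>R \<beta> t"] b(1) b(2)[OF that] c(1) c(2)[OF that]
    by (simp_all add: mult.commute) blast+
  obtain g d h e where g: "invertible g" "\<beta> = (\<lambda>t\<in>{0..}. cdiag g (\<lambda>i. exp (t * d i)))"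
    and h: "invertible h" "\<gamma> = (\<lambda>t\<in>{0..}. cdiag h (\<lambda>i. exp (t * e i)))"
    using assms(1,2) by (auto simp: asymptotic_rays_iff unit_rays_iff)
  define f where "f = matrix_inv g"
  have fg: "f ** g = mat 1"
    using g(1) by (simp add: f_def matrix_mul_inv_left)
  define k where "k = f ** h"
  have "g ** transpose g = h ** transpose h"
    using start by (simp add: g h cdiag_one)
  then have "k ** transpose k = (f ** g) ** transpose (f ** g)"
    by (simp add: k_def matrix_transpose_mul) (metis matrix_mul_assoc)
  then have k: "orthogonal_matrix k"
    by (simp add: fg orthogonal_matrix matrix_left_right_inverse[of k])
  have \<beta>: "f ** cdiag g a ** transpose f = cdiag (mat 1) a" for a
    by (simp add: cdiag_congruence fg)
  have \<gamma>: "f ** cdiag h a ** transpose f = cdiag k a" for a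
    by (simp add: cdiag_congruence k_def)
  have "loewner_le (cdiag (mat 1) (\<lambda>i. exp (t * d i))) ((b * c) *\<^sub>R cdiag k (\<lambda>i. exp (t * e i)))" if "0 \<le> t" for t
    using loewner_le_congruence[OF le(1)[OF that], of f] that by (simp add: g h cdiag_scaleR \<beta> \<gamma>)
  then have "loewner_le (cdiag (mat 1) d) (cdiag k e)"
    using b(1) c(1) by (intro loewner_le_if_exp_dominated[of _ _ "b * c"] orthogonal_matrix_id k) simp_all
  moreover have "loewner_le (cdiag k (\<lambda>i. exp (t * e i))) ((b * c) *\<^sub>R cdiag (mat 1) (\<lambda>i. exp (t * d i)))" if "0 \<le> t" for t
    using loewner_le_congruence[OF le(2)[OF that], of f] that by (simp add: g h cdiag_scaleR \<beta> \<gamma>)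
  then have "loewner_le (cdiag k e) (cdiag (mat 1) d)"
    using b(1) c(1) by (intro loewner_le_if_exp_dominated[of _ _ "b * c"] orthogonal_matrix_id k) simp_all
  ultimately have eq: "cdiag (mat 1) d = cdiag k e"
    by (intro loewner_le_antisym cdiag_in_sym_mats)
  \<comment> \<open>At the identity a ray is the exponential of \<open>t\<close> times its velocity,
    so equal velocities give equal rays; \<open>g\<close> then moves them back.\<close>
  have "cdiag (mat 1) (\<lambda>i. exp (t * d i)) = cdiag k (\<lambda>i. exp (t * e i))" for t
    using arg_cong[OF eq, of "\<lambda>X. mat_exp (t *\<^sub>R X)"]
    by (simp add: cdiag_scaleR mat_exp_cdiag k orthogonal_matrix_id)
  then have "g ** cdiag (mat 1) (\<lambda>i. exp (t * d i)) ** transpose g = g ** cdiag k (\<lambda>i. exp (t * e i)) ** transpose g" for t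
    by simp
  moreover have "g ** k = h"
    using g(1) by (simp add: k_def f_def matrix_mul_assoc matrix_mul_inv_right)
  ultimately show ?thesis
    by (simp add: g h cdiag_congruence)
qed

section \<open>Calculus of \<open>C\<^sup>k\<close> maps\<close>

lemma Ck_on_cong:
  assumes "Ck_on k S U f" "\<And>x. x \<in> U \<Longrightarrow> f x = g x"
  shows "Ck_on k S U g"
proof (cases k)
  case 0
  then show ?thesis
    using assms continuous_on_cong[of U U f g] by simp
next
  case (Suc l)
  then obtain f' where f': "\<And>x. x \<in> U \<Longrightarrow> (f has_derivative f' x) (at x within U)"
    "\<And>v. v \<in> S \<Longrightarrow> Ck_on l S U (\<lambda>x. f' x v)"
    using assms(1) by auto
  have "(g has_derivative f' x) (at x within U)" if "x \<in> U" for x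
    using f'(1)[OF that] that assms(2) by (metis has_derivative_transform)
  then show ?thesis
    using f'(2) Suc by auto
qed

text \<open>The product and reciprocal rules reproduce the undifferentiated functions beside the
  derivatives, where they are needed with one order less.\<close>

lemma Ck_on_Suc_imp: "Ck_on (Suc k) S U f \<Longrightarrow> Ck_on k S U f"
proof (induction k arbitrary: f)
  case 0
  then show ?case
    by (auto simp: continuous_on_eq_continuous_within intro: has_derivative_continuous)
next
  case (Suc k)
  then show ?case
    by (simp only: Ck_on.simps(2)) blast
qed

lemma Ck_on_SucI:
  assumes "\<And>x. x \<in> U \<Longrightarrow> (f has_derivative f' x) (at x within U)"
    and "\<And>v. v \<in> S \<Longrightarrow> Ck_on k S U (\<lambda>x. f' x v)"
  shows "Ck_on (Suc k) S U f"
  using assms unfolding Ck_on.simps by blast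

lemma Ck_on_const: "Ck_on k S U (\<lambda>_. c)"
proof (induction k arbitrary: c)
  case (Suc k)
  show ?case
    by (rule Ck_on_SucI[where f' = "\<lambda>_ _. 0"]) (auto intro: Suc)
qed simp

lemma Ck_on_ident: "Ck_on k S U (\<lambda>x. x)"
proof (cases k)
  case (Suc l)
  show ?thesis
    unfolding Suc by (rule Ck_on_SucI[where f' = "\<lambda>_ v. v"]) (auto intro: Ck_on_const)
qed simp

lemma Ck_on_bounded_linear:
  assumes "bounded_linear L" "Ck_on k S U f"
  shows "Ck_on k S U (\<lambda>x. L (f x))"
  using assms(2)
proof (induction k arbitrary: f)
  case 0
  then show ?case
    using bounded_linear.continuous_on[OF assms(1)] by simp
next
  case (Suc k)
  obtain f' where f': "\<And>x. x \<in> U \<Longrightarrow> (f has_derivative f' x) (at x within U)"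
    "\<And>v. v \<in> S \<Longrightarrow> Ck_on k S U (\<lambda>x. f' x v)"
    using Suc.prems unfolding Ck_on.simps by blast
  show ?case
    by (rule Ck_on_SucI[where f' = "\<lambda>x v. L (f' x v)"])
       (auto intro: bounded_linear.has_derivative[OF assms(1)] f' Suc.IH)
qed

lemma Ck_on_add:
  assumes "Ck_on k S U f" "Ck_on k S U g"
  shows "Ck_on k S U (\<lambda>x. f x + g x)"
  using assms
proof (induction k arbitrary: f g)
  case 0
  then show ?case
    by (simp add: continuous_on_add)
next
  case (Suc k)
  obtain f' where f': "\<And>x. x \<in> U \<Longrightarrow> (f has_derivative f' x) (at x within U)"
    "\<And>v. v \<in> S \<Longrightarrow> Ck_on k S U (\<lambda>x. f' x v)"
    using Suc.prems(1) unfolding Ck_on.simps by blast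
  obtain g' where g': "\<And>x. x \<in> U \<Longrightarrow> (g has_derivative g' x) (at x within U)"
    "\<And>v. v \<in> S \<Longrightarrow> Ck_on k S U (\<lambda>x. g' x v)"
    using Suc.prems(2) unfolding Ck_on.simps by blast
  show ?case
    by (rule Ck_on_SucI[where f' = "\<lambda>x v. f' x v + g' x v"])
       (auto intro: has_derivative_add f' g' Suc.IH)
qed

lemma Ck_on_sum:
  assumes "\<And>i. i \<in> I \<Longrightarrow> Ck_on k S U (f i)"
  shows "Ck_on k S U (\<lambda>x. \<Sum>i\<in>I. f i x)"
  using assms by (induction I rule: infinite_finite_induct) (simp_all add: Ck_on_const Ck_on_add)

lemma Ck_on_mult:
  fixes f g :: "'a::euclidean_space \<Rightarrow> real"
  assumes "Ck_on k S U f" "Ck_on k S U g"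
  shows "Ck_on k S U (\<lambda>x. f x * g x)"
  using assms
proof (induction k arbitrary: f g)
  case 0
  then show ?case
    by (simp add: continuous_on_mult)
next
  case (Suc k)
  obtain f' where f': "\<And>x. x \<in> U \<Longrightarrow> (f has_derivative f' x) (at x within U)"
    "\<And>v. v \<in> S \<Longrightarrow> Ck_on k S U (\<lambda>x. f' x v)"
    using Suc.prems(1) unfolding Ck_on.simps by blast
  obtain g' where g': "\<And>x. x \<in> U \<Longrightarrow> (g has_derivative g' x) (at x within U)"
    "\<And>v. v \<in> S \<Longrightarrow> Ck_on k S U (\<lambda>x. g' x v)"
    using Suc.prems(2) unfolding Ck_on.simps by blast
  show ?case
    by (rule Ck_on_SucI[where f' = "\<lambda>x v. f x * g' x v + f' x v * g x"])
       (auto intro!: has_derivative_mult f' g' Ck_on_add Suc.IH Suc.prems[THEN Ck_on_Suc_imp])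
qed

lemma Ck_on_prod:
  fixes f :: "'i \<Rightarrow> 'a::euclidean_space \<Rightarrow> real"
  assumes "\<And>i. i \<in> I \<Longrightarrow> Ck_on k S U (f i)"
  shows "Ck_on k S U (\<lambda>x. \<Prod>i\<in>I. f i x)"
  using assms by (induction I rule: infinite_finite_induct) (simp_all add: Ck_on_const Ck_on_mult)

text \<open>The derivative is a product of \<open>f'\<close> with the reciprocal itself, so the
  induction hypothesis for the same \<open>f\<close> suffices.\<close>

lemma Ck_on_inverse:
  fixes f :: "'a::euclidean_space \<Rightarrow> real"
  assumes "Ck_on k S U f" "\<And>x. x \<in> U \<Longrightarrow> f x \<noteq> 0"
  shows "Ck_on k S U (\<lambda>x. inverse (f x))"
  using assms(1)
proof (induction k)
  case 0
  then show ?case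
    using assms(2) by (simp add: continuous_on_inverse)
next
  case (Suc k)
  obtain f' where f': "\<And>x. x \<in> U \<Longrightarrow> (f has_derivative f' x) (at x within U)"
    "\<And>v. v \<in> S \<Longrightarrow> Ck_on k S U (\<lambda>x. f' x v)"
    using Suc.prems(1) unfolding Ck_on.simps by blast
  have inv: "Ck_on k S U (\<lambda>x. inverse (f x))"
    using Suc.IH Suc.prems Ck_on_Suc_imp by blast
  show ?case
  proof (rule Ck_on_SucI[where f' = "\<lambda>x v. - (inverse (f x) * f' x v * inverse (f x))"])
    show "((\<lambda>x. inverse (f x)) has_derivative (\<lambda>v. - (inverse (f x) * f' x v * inverse (f x)))) (at x within U)"
      if "x \<in> U" for x
      by (rule Deriv.has_derivative_inverse[OF assms(2)[OF that] f'(1)[OF that]])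
    show "Ck_on k S U (\<lambda>x. - (inverse (f x) * f' x v * inverse (f x)))" if "v \<in> S" for v
      by (rule Ck_on_bounded_linear[OF bounded_linear_minus[OF bounded_linear_ident]]) (intro Ck_on_mult inv f' that)
  qed
qed

lemma Ck_on_vec:
  fixes f :: "'a::euclidean_space \<Rightarrow> 'b::euclidean_space^'n"
  assumes "\<And>i. Ck_on k S U (\<lambda>x. f x $ i)"
  shows "Ck_on k S U f"
proof -
  have eq: "f x = (\<Sum>i\<in>UNIV. axis i (f x $ i))" for x
    by (simp add: vec_eq_iff axis_def sum_component)
  have "bounded_linear (axis i :: 'b \<Rightarrow> 'b^'n)" for i
    by (simp add: linear_conv_bounded_linear[symmetric] linear_iff vec_eq_iff axis_def)
  then have "Ck_on k S U (\<lambda>x. axis i (f x $ i))" for i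
    using assms by (rule Ck_on_bounded_linear)
  then have "Ck_on k S U (\<lambda>x. \<Sum>i\<in>UNIV. axis i (f x $ i))"
    by (rule Ck_on_sum)
  then show ?thesis
    unfolding eq[symmetric] .
qed

lemma Ck_on_nth:
  fixes f :: "'a::euclidean_space \<Rightarrow> 'b::real_normed_vector^'n"
  shows "Ck_on k S U f \<Longrightarrow> Ck_on k S U (\<lambda>x. f x $ i)"
  by (rule Ck_on_bounded_linear[OF bounded_linear_vec_nth])

lemma Ck_on_det:
  fixes f :: "'a::euclidean_space \<Rightarrow> real^'n^'n"
  assumes "\<And>i j. Ck_on k S U (\<lambda>x. f x $ i $ j)"
  shows "Ck_on k S U (\<lambda>x. det (f x))"
  unfolding det_def by (intro Ck_on_sum Ck_on_mult Ck_on_prod Ck_on_const assms)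

text \<open>Cramer's rule for the system with right-hand side \<open>axis j 1\<close>, whose
  solution is column \<open>j\<close> of the inverse. Regularity of inversion is thereby reduced to
  determinants and one scalar reciprocal.\<close>

lemma matrix_inv_nth:
  fixes A :: "real^'n^'n"
  assumes "invertible A"
  shows "matrix_inv A $ k $ j = det (\<chi> a b. if b = k then axis j 1 $ a else A $ a $ b) * inverse (det A)"
proof -
  have "A *v (matrix_inv A *v axis j 1) = axis j 1"
    by (simp add: matrix_vector_mul_assoc matrix_mul_inv_right assms)
  moreover have "det A \<noteq> 0"
    using assms invertible_det_nz by blast
  ultimately have "matrix_inv A *v axis j 1 = (\<chi> k. det (\<chi> a b. if b = k then axis j 1 $ a else A $ a $ b) / det A)"
    by (simp add: cramer)
  moreover have "(matrix_inv A *v axis j 1) $ k = matrix_inv A $ k $ j"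
    by (simp add: matrix_vector_mul_component inner_axis)
  ultimately show ?thesis
    by (simp add: divide_inverse)
qed

lemma Ck_on_matrix_inv:
  fixes f :: "'a::euclidean_space \<Rightarrow> real^'n^'n"
  assumes "Ck_on k S U f" "\<And>x. x \<in> U \<Longrightarrow> invertible (f x)"
  shows "Ck_on k S U (\<lambda>x. matrix_inv (f x))"
proof (intro Ck_on_vec)
  fix i j
  have f: "Ck_on k S U (\<lambda>x. f x $ a $ b)" for a b
    using assms(1) by (intro Ck_on_nth)
  have "Ck_on k S U (\<lambda>x. det (\<chi> a b. if b = i then axis j 1 $ a else f x $ a $ b) * inverse (det (f x)))"
  proof (intro Ck_on_mult Ck_on_inverse Ck_on_det f)
    show "Ck_on k S U (\<lambda>x. (\<chi> a b. if b = i then axis j 1 $ a else f x $ a $ b) $ a $ b)" for a b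
      by (cases "b = i") (simp_all add: f Ck_on_const)
    show "det (f x) \<noteq> 0" if "x \<in> U" for x
      using assms(2)[OF that] invertible_det_nz by blast
  qed
  then show "Ck_on k S U (\<lambda>x. matrix_inv (f x) $ i $ j)"
    by (rule Ck_on_cong) (simp add: matrix_inv_nth assms(2))
qed

lemma Ck_on_matrix_mult_const:
  fixes f :: "'a::euclidean_space \<Rightarrow> real^'n^'n"
  assumes "Ck_on k S U f"
  shows "Ck_on k S U (\<lambda>x. A ** f x ** B)"
proof -
  have "linear (\<lambda>X. A ** X ** B)"
    by (simp add: linear_iff matrix_matrix_mult_def vec_eq_iff
        algebra_simps sum.distrib sum_distrib_left)
  then have "bounded_linear (\<lambda>X. A ** X ** B)"
    by (simp add: linear_conv_bounded_linear)
  then show ?thesis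
    using assms by (rule Ck_on_bounded_linear)
qed

section \<open>Triangular matrices with respect to a flag\<close>

text \<open>Only the preorder that \<open>d\<close> induces on the indices matters; when \<open>d\<close> has repeated values,
  these are the block triangular matrices, that is, the stabiliser of a partial flag.\<close>

definition triangular :: "('m \<Rightarrow> real) \<Rightarrow> real^'m^'m \<Rightarrow> bool" where
  "triangular d T \<longleftrightarrow> (\<forall>i j. T $ i $ j \<noteq> 0 \<longrightarrow> d j \<le> d i)"

lemma triangular_mult:
  assumes "triangular d A" "triangular d B"
  shows "triangular d (A ** B)"
  unfolding triangular_def
proof (intro allI impI)
  fix i j
  assume "(A ** B) $ i $ j \<noteq> 0"
  then obtain k where "A $ i $ k * B $ k $ j \<noteq> 0"
    unfolding matrix_matrix_mult_def by (auto elim: sum.not_neutral_contains_not_neutral)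
  then have "d k \<le> d i" "d j \<le> d k"
    using assms by (auto simp: triangular_def)
  then show "d j \<le> d i"
    by simp
qed

lemma triangular_diag: "triangular d (diag a)"
  by (simp add: triangular_def diag_nth)

lemma triangular_mat_1: "triangular d (mat 1)"
  using triangular_diag[of d "\<lambda>_. 1"] by (simp add: diag_one)

section \<open>Cholesky factorization adapted to the flag\<close>

lemma pd_mats_diagonal_pos: "A \<in> pd_mats \<Longrightarrow> 0 < A $ k $ k"
  using pd_mats_pos[of A "axis k 1"]
  by (simp add: axis_eq_0_iff inner_axis' matrix_vector_mul_component inner_axis)

text \<open>Symmetric Gaussian elimination with the positive pivot \<open>z $ k $ k\<close>. The
  multipliers \<open>c\<close> vanish on the cleared rows \<open>A\<close>, and outside
  \<open>A\<close> the pivot index minimises \<open>d\<close>, so \<open>mat 1 - C\<close> is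
  triangular. Since \<open>c k = 0\<close>, \<open>C\<close> squares to zero and
  \<open>mat 1 + C\<close> is the inverse, triangular as well.\<close>

lemma triangular_elimination_step:
  fixes z :: "real^'m^'m"
  assumes z: "z \<in> pd_mats" and "k \<notin> A" and min: "\<And>i. i \<notin> A \<Longrightarrow> d k \<le> d i"
    and clean: "\<And>i j. i \<in> A \<Longrightarrow> j \<noteq> i \<Longrightarrow> z $ i $ j = 0"
  obtains E F where "triangular d E" "triangular d F" "E ** F = mat 1"
    "\<And>i j. i \<in> insert k A \<Longrightarrow> j \<noteq> i \<Longrightarrow> (E ** z ** transpose E) $ i $ j = 0"
proof -
  define c where "c i = (if i = k then 0 else z $ i $ k / z $ k $ k)" for i
  define C :: "real^'m^'m" where "C = (\<chi> i j. if j = k then c i else 0)"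
  have zkk: "0 < z $ k $ k"
    by (rule pd_mats_diagonal_pos[OF z])
  have z_sym: "z $ i $ j = z $ j $ i" for i j
    using arg_cong[OF pd_mats_transpose[OF z], of "\<lambda>X. X $ j $ i"] by (simp add: transpose_def)
  have C_left: "(C ** X) $ i $ j = c i * X $ k $ j" for X :: "real^'m^'m" and i j
  proof -
    have "(C ** X) $ i $ j = (\<Sum>l\<in>UNIV. if l = k then c i * X $ k $ j else 0)"
      unfolding matrix_matrix_mult_def vec_lambda_beta by (rule sum.cong) (auto simp: C_def)
    then show ?thesis
      by simp
  qed
  have C_right: "(X ** transpose C) $ i $ j = X $ i $ k * c j" for X :: "real^'m^'m" and i j
  proof -
    have "(X ** transpose C) $ i $ j = (\<Sum>l\<in>UNIV. if l = k then X $ i $ k * c j else 0)"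
      unfolding matrix_matrix_mult_def vec_lambda_beta by (rule sum.cong) (auto simp: C_def transpose_def)
    then show ?thesis
      by simp
  qed
  have "C ** C = 0"
    by (simp add: vec_eq_iff C_left) (simp add: C_def c_def)
  then have inv: "(mat 1 - C) ** (mat 1 + C) = mat 1"
    by (simp add: matrix_add_ldistrib matrix_diff_rdistrib)
  have c_A: "c i = 0" if "i \<in> A" for i
    using clean[OF that, of k] that \<open>k \<notin> A\<close> by (auto simp: c_def)
  have le: "d k \<le> d i" if "c i \<noteq> 0" for i
    using c_A min that by blast
  have tri: "triangular d (mat 1 - C)" "triangular d (mat 1 + C)"
    using le by (auto simp: triangular_def mat_def C_def split: if_splits)
  have entry: "((mat 1 - C) ** z ** transpose (mat 1 - C)) $ i $ j
      = (z $ i $ j - c i * z $ k $ j) - (z $ i $ k - c i * z $ k $ k) * c j" for i j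
    by (simp add: transpose_diff matrix_diff_ldistrib C_right)
       (simp add: matrix_diff_rdistrib C_left algebra_simps)
  have "((mat 1 - C) ** z ** transpose (mat 1 - C)) $ i $ j = 0" if "i \<in> insert k A" "j \<noteq> i" for i j
  proof (cases "i = k")
    case True
    then show ?thesis
      using that zkk unfolding entry by (simp add: c_def z_sym[of k j])
  next
    case False
    then have "i \<in> A" "k \<noteq> i"
      using that by auto
    then show ?thesis
      unfolding entry using clean that(2) by (simp add: c_A)
  qed
  then show thesis
    using that tri inv by blast
qed

text \<open>Pivots are taken in order of increasing \<open>d\<close>; \<open>A\<close> collects
  those already used. The inverse \<open>F\<close> is built alongside \<open>E\<close> so that its
  triangularity is at hand.\<close>

lemma triangular_elimination:
  fixes y :: "real^'m^'m"
  assumes y: "y \<in> pd_mats" and "n \<le> CARD('m)"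
  shows "\<exists>A E F. card A = n \<and> (\<forall>i\<in>A. \<forall>j. j \<noteq> i \<longrightarrow> (E ** y ** transpose E) $ i $ j = 0)
    \<and> triangular d E \<and> triangular d F \<and> E ** F = mat 1"
  using assms(2)
proof (induction n)
  case 0
  show ?case
    by (intro exI[of _ "{}"] exI[of _ "mat 1"]) (simp add: triangular_mat_1)
next
  case (Suc n)
  then have "n \<le> CARD('m)"
    by simp
  from Suc.IH[OF this] obtain A E F where A: "card A = n"
    "\<forall>i\<in>A. \<forall>j. j \<noteq> i \<longrightarrow> (E ** y ** transpose E) $ i $ j = 0"
    and E: "triangular d E" "triangular d F" "E ** F = mat 1"
    by (elim exE conjE) (rule that)
  have "A \<noteq> UNIV"
    using A(1) Suc.prems by auto
  then obtain k where k: "is_arg_min d (\<lambda>i. i \<in> - A) k"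
    using ex_is_arg_min_if_finite[of "- A" d] by auto
  have "k \<notin> A" "\<And>i. i \<notin> A \<Longrightarrow> d k \<le> d i"
    using k by (auto simp: is_arg_min_linorder)
  moreover have "E ** y ** transpose E \<in> pd_mats"
    using E(3) y invertible_right_inverse by (blast intro: congruence_in_pd_mats)
  ultimately obtain E' F' where E': "triangular d E'" "triangular d F'" "E' ** F' = mat 1"
    "\<And>i j. i \<in> insert k A \<Longrightarrow> j \<noteq> i \<Longrightarrow> (E' ** (E ** y ** transpose E) ** transpose E') $ i $ j = 0"
    using A(2) by (elim triangular_elimination_step[where A = A and d = d]) auto
  have "(E' ** E) ** (F ** F') = E' ** (E ** F) ** F'"
    by (simp only: matrix_mul_assoc)
  then have "(E' ** E) ** (F ** F') = mat 1"
    using E(3) E'(3) by simp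
  moreover have "E' ** (E ** y ** transpose E) ** transpose E' = (E' ** E) ** y ** transpose (E' ** E)"
    by (simp add: matrix_transpose_mul matrix_mul_assoc)
  ultimately show ?case
    using A(1) E E' \<open>k \<notin> A\<close>
    by (intro exI[of _ "insert k A"] exI[of _ "E' ** E"] exI[of _ "F ** F'"]) (simp add: triangular_mult)
qed

text \<open>Complete elimination leaves a positive diagonal matrix, whose square root is absorbed
  into the triangular factor.\<close>

lemma triangular_factorization:
  fixes y :: "real^'m^'m"
  assumes y: "y \<in> pd_mats"
  obtains T T' where "triangular d T" "triangular d T'" "T ** T' = mat 1" "y = T ** transpose T"
proof -
  from triangular_elimination[OF y order_refl, where d = d] obtain A E F where A: "card A = CARD('m)"
    and off: "\<forall>i\<in>A. \<forall>j. j \<noteq> i \<longrightarrow> (E ** y ** transpose E) $ i $ j = 0"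
    and E: "triangular d E" "triangular d F" "E ** F = mat 1"
    by (elim exE conjE) (rule that)
  have "A = UNIV"
    using A by (simp add: card_eq_UNIV_imp_eq_UNIV)
  define e where "e i = (E ** y ** transpose E) $ i $ i" for i
  have FE: "F ** E = mat 1"
    using E(3) matrix_left_right_inverse by blast
  have "E ** y ** transpose E \<in> pd_mats"
    using E(3) y invertible_right_inverse by (blast intro: congruence_in_pd_mats)
  then have e: "0 < e i" for i
    unfolding e_def by (rule pd_mats_diagonal_pos)
  have diag: "E ** y ** transpose E = diag e"
    using off \<open>A = UNIV\<close> by (auto simp: vec_eq_iff diag_nth e_def)
  have "cdiag F e = (F ** E) ** y ** transpose (F ** E)"
    unfolding cdiag_def diag[symmetric] by (simp add: matrix_transpose_mul matrix_mul_assoc)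
  then have y_eq: "y = cdiag F e"
    by (simp add: FE)
  define T where "T = F ** diag (\<lambda>i. sqrt (e i))"
  define T' where "T' = diag (\<lambda>i. 1 / sqrt (e i)) ** E"
  have "T ** transpose T = F ** (diag (\<lambda>i. sqrt (e i)) ** diag (\<lambda>i. sqrt (e i))) ** transpose F"
    by (simp add: T_def matrix_transpose_mul matrix_mul_assoc)
  then have "y = T ** transpose T"
    using e by (simp add: y_eq cdiag_def diag_mult less_imp_le)
  moreover have "T ** T' = F ** (diag (\<lambda>i. sqrt (e i)) ** diag (\<lambda>i. 1 / sqrt (e i))) ** E"
    by (simp add: T_def T'_def matrix_mul_assoc)
  then have "T ** T' = mat 1"
    using e by (simp add: diag_mult less_imp_neq[THEN not_sym] diag_one FE)
  moreover have "triangular d T" "triangular d T'"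
    by (simp_all add: T_def T'_def triangular_mult triangular_diag E)
  ultimately show thesis
    using that by blast
qed

text \<open>Conjugating a triangular matrix by \<open>diag (exp (t d / 2))\<close> multiplies its entries by
  exponentials with nonpositive exponents, so it stays bounded as \<open>t\<close> grows.\<close>

lemma triangular_imp_exp_dominated:
  fixes g :: "real^'m^'m"
  assumes T: "triangular d T"
  obtains c where "0 < c"
    "\<And>t. 0 \<le> t \<Longrightarrow> loewner_le (cdiag (g ** T) (\<lambda>i. exp (t * d i))) (c *\<^sub>R cdiag g (\<lambda>i. exp (t * d i)))"
proof -
  define K where "K = (\<Sum>i\<in>UNIV. \<Sum>j\<in>UNIV. (T $ j $ i)\<^sup>2)"
  \<comment> \<open>\<open>K\<close> is the squared Frobenius norm of \<open>T\<close>, the factor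
    \<open>CARD('m)\<close> comes from the Cauchy-Schwarz inequality, and \<open>+ 1\<close> makes
    \<open>c\<close> positive even for \<open>T = 0\<close>.\<close>
  define c where "c = CARD('m) * K + 1"
  have "0 \<le> K"
    by (simp add: K_def sum_nonneg)
  then have c: "0 < c" "CARD('m) * K \<le> c"
    by (simp_all add: c_def add_nonneg_pos)
  have "u \<bullet> (cdiag (g ** T) (\<lambda>i. exp (t * d i)) *v u) \<le> c * (u \<bullet> (cdiag g (\<lambda>i. exp (t * d i)) *v u))"
    if t: "0 \<le> t" for t u
  proof -
    define w where "w = transpose g *v u"
    define p where "p j = exp (t * d j) * (w $ j)\<^sup>2" for j
    have p: "0 \<le> p j" for j
      by (simp add: p_def)
    have Tw: "transpose (g ** T) *v u = transpose T *v w"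
      by (simp add: w_def matrix_transpose_mul matrix_vector_mul_assoc del: transpose_matrix_vector)
    have row: "exp (t * d i) * ((transpose T *v w) $ i)\<^sup>2 \<le> CARD('m) * (\<Sum>j\<in>UNIV. (T $ j $ i)\<^sup>2 * sum p UNIV)" for i
    proof -
      have "((transpose T *v w) $ i)\<^sup>2 = (\<Sum>j\<in>UNIV. T $ j $ i * w $ j)\<^sup>2"
        by (simp add: matrix_vector_mult_def transpose_def del: transpose_matrix_vector)
      also have "\<dots> \<le> (\<Sum>j\<in>UNIV. (T $ j $ i * w $ j)\<^sup>2) * CARD('m)"
        by (rule sum_squared_le_sum_of_squares)
      finally have "exp (t * d i) * ((transpose T *v w) $ i)\<^sup>2
          \<le> exp (t * d i) * ((\<Sum>j\<in>UNIV. (T $ j $ i * w $ j)\<^sup>2) * CARD('m))"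
        by simp
      also have "\<dots> = CARD('m) * (\<Sum>j\<in>UNIV. exp (t * d i) * (T $ j $ i * w $ j)\<^sup>2)"
        by (simp add: sum_distrib_left sum_distrib_right ac_simps)
      also have "\<dots> \<le> CARD('m) * (\<Sum>j\<in>UNIV. (T $ j $ i)\<^sup>2 * sum p UNIV)"
      proof (intro mult_left_mono sum_mono)
        fix j
        have "exp (t * d i) * (T $ j $ i * w $ j)\<^sup>2 \<le> (T $ j $ i)\<^sup>2 * p j"
        proof (cases "T $ j $ i = 0")
          case False
          \<comment> \<open>Triangularity enters here: a nonzero entry \<open>T $ j $ i\<close>
            forces \<open>d i \<le> d j\<close>, so for \<open>t \<ge> 0\<close> the exponentials
            compare in the right direction.\<close>
          then have "exp (t * d i) \<le> exp (t * d j)"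
            using T t by (simp add: triangular_def mult_left_mono)
          then have "(T $ j $ i * w $ j)\<^sup>2 * exp (t * d i) \<le> (T $ j $ i * w $ j)\<^sup>2 * exp (t * d j)"
            by (rule mult_left_mono) simp
          then show ?thesis
            by (simp add: p_def power_mult_distrib ac_simps)
        qed simp
        also have "\<dots> \<le> (T $ j $ i)\<^sup>2 * sum p UNIV"
          by (intro mult_left_mono member_le_sum) (auto simp: p)
        finally show "exp (t * d i) * (T $ j $ i * w $ j)\<^sup>2 \<le> (T $ j $ i)\<^sup>2 * sum p UNIV" .
      qed simp
      finally show ?thesis .
    qed
    have sum_K: "(\<Sum>i\<in>UNIV. CARD('m) * (\<Sum>j\<in>UNIV. (T $ j $ i)\<^sup>2 * s)) = CARD('m) * K * s" for s
      by (simp add: K_def sum_distrib_left sum_distrib_right mult.assoc)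
    have "u \<bullet> (cdiag (g ** T) (\<lambda>i. exp (t * d i)) *v u)
        \<le> (\<Sum>i\<in>UNIV. CARD('m) * (\<Sum>j\<in>UNIV. (T $ j $ i)\<^sup>2 * sum p UNIV))"
      unfolding inner_cdiag Tw by (intro sum_mono row)
    also have "\<dots> \<le> c * sum p UNIV"
      unfolding sum_K
      by (intro mult_right_mono c sum_nonneg p)
    also have "sum p UNIV = u \<bullet> (cdiag g (\<lambda>i. exp (t * d i)) *v u)"
      unfolding inner_cdiag p_def w_def ..
    finally show ?thesis .
  qed
  then show thesis
    using that[of c] c(1) by (simp add: loewner_le_def scaleR_matrix_vector_assoc[symmetric])
qed

text \<open>The reverse domination is the forward one for \<open>g ** T\<close> and
  \<open>T'\<close>, because \<open>g ** T ** T' = g\<close>.\<close>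

lemma triangular_imp_asymptotic:
  assumes g: "invertible g" and d: "(\<Sum>i\<in>UNIV. (d i)\<^sup>2) = 1"
    and T: "triangular d T" "triangular d T'" "T ** T' = mat 1"
  shows "(\<lambda>t\<in>{0..}. cdiag g (\<lambda>i. exp (t * d i)), \<lambda>t\<in>{0..}. cdiag (g ** T) (\<lambda>i. exp (t * d i)))
    \<in> asymptotic_rays"
proof -
  have "invertible T"
    using T(3) invertible_right_inverse by blast
  then have gT: "invertible (g ** T)"
    by (rule invertible_mult[OF g])
  obtain a where a: "0 < a" "\<And>t. 0 \<le> t \<Longrightarrow> loewner_le (cdiag (g ** T) (\<lambda>i. exp (t * d i))) (a *\<^sub>R cdiag g (\<lambda>i. exp (t * d i)))"
    using triangular_imp_exp_dominated[OF T(1)] by blast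
  have "g ** T ** T' = g"
    by (simp add: matrix_mul_assoc[symmetric] T(3))
  then obtain b where b: "0 < b" "\<And>t. 0 \<le> t \<Longrightarrow> loewner_le (cdiag g (\<lambda>i. exp (t * d i))) (b *\<^sub>R cdiag (g ** T) (\<lambda>i. exp (t * d i)))"
    using triangular_imp_exp_dominated[OF T(2), of "g ** T"] by metis
  define \<alpha> where "\<alpha> = (\<lambda>t\<in>{0..}. cdiag g (\<lambda>i. exp (t * d i)))"
  define \<beta> where "\<beta> = (\<lambda>t\<in>{0..}. cdiag (g ** T) (\<lambda>i. exp (t * d i)))"
  have rays: "\<alpha> \<in> unit_rays" "\<beta> \<in> unit_rays"
    unfolding unit_rays_iff \<alpha>_def \<beta>_def using g gT d by blast+
  have "loewner_le (\<beta> t) (max a b *\<^sub>R \<alpha> t) \<and> loewner_le (\<alpha> t) (max a b *\<^sub>R \<beta> t)" if t: "0 \<le> t" for t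
  proof
    show "loewner_le (\<beta> t) (max a b *\<^sub>R \<alpha> t)"
      using a(2)[OF t] t loewner_le_scaleR_mono[OF unit_ray_in_pd_mats[OF rays(1) t], of a "max a b"]
      by (auto simp: \<alpha>_def \<beta>_def intro: loewner_le_trans)
    show "loewner_le (\<alpha> t) (max a b *\<^sub>R \<beta> t)"
      using b(2)[OF t] t loewner_le_scaleR_mono[OF unit_ray_in_pd_mats[OF rays(2) t], of b "max a b"]
      by (auto simp: \<alpha>_def \<beta>_def intro: loewner_le_trans)
  qed
  then have "(\<alpha>, \<beta>) \<in> asymptotic_rays"
    unfolding asymptotic_rays_iff using rays a(1) by (intro conjI exI[of _ "max a b"]) auto
  then show ?thesis
    by (simp only: \<alpha>_def \<beta>_def)
qed

section \<open>Flag projections and the elimination of the triangular factor\<close>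

definition flag_proj :: "('m \<Rightarrow> real) \<Rightarrow> real \<Rightarrow> real^'m^'m" where
  "flag_proj d r = diag (\<lambda>i. if r \<le> d i then 1 else 0)"

lemma flag_proj_idem: "flag_proj d r ** flag_proj d r = flag_proj d r"
  by (simp add: flag_proj_def diag_mult if_distrib cong: if_cong)

lemma transpose_flag_proj: "transpose (flag_proj d r) = flag_proj d r"
  by (simp add: flag_proj_def)

text \<open>The coordinates with \<open>d i \<ge> r\<close> span a subspace that every triangular
  matrix maps into itself.\<close>

lemma triangular_flag_proj:
  assumes "triangular d T"
  shows "flag_proj d r ** T ** flag_proj d r = T ** flag_proj d r"
proof -
  have "T $ i $ j = 0" if "\<not> r \<le> d i" "r \<le> d j" for i j
    using assms that unfolding triangular_def by (meson order_trans)
  then show ?thesis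
    by (simp add: vec_eq_iff flag_proj_def matrix_mult_diag_nth diag_matrix_mult_nth)
qed

text \<open>So \<open>T Q T\<^sup>T\<close> depends on \<open>T\<close> only through \<open>T T\<^sup>T\<close>, by linear maps and matrix inversions.\<close>

lemma congruence_flag_proj:
  fixes T T' :: "real^'m^'m" and r :: real
  assumes T: "triangular d T" "triangular d T'" "T ** T' = mat 1"
  defines "Q \<equiv> flag_proj d r"
  shows "(Q ** matrix_inv (T ** transpose T) ** Q + (mat 1 - Q)) ** (T ** Q ** transpose T + (mat 1 - Q)) = mat 1"
proof -
  have T'T: "T' ** T = mat 1"
    using T(3) matrix_left_right_inverse by blast
  have tr: "transpose T ** transpose T' = mat 1" "transpose T' ** transpose T = mat 1"
    by (simp_all add: matrix_transpose_mul[symmetric] T'T T(3))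
  have QQ: "Q ** Q = Q" and tQ: "transpose Q = Q"
    by (simp_all add: Q_def flag_proj_idem transpose_flag_proj)
  have QTQ: "Q ** T ** Q = T ** Q" and QT'Q: "Q ** T' ** Q = T' ** Q"
    by (simp_all add: Q_def triangular_flag_proj T)
  have QtT: "Q ** transpose T ** Q = Q ** transpose T" and QtT': "Q ** transpose T' ** Q = Q ** transpose T'"
    using arg_cong[OF QTQ, of transpose] arg_cong[OF QT'Q, of transpose]
    by (simp_all add: matrix_transpose_mul tQ matrix_mul_assoc)
  have "(T ** transpose T) ** (transpose T' ** T') = T ** (transpose T ** transpose T') ** T'"
    by (simp only: matrix_mul_assoc)
  then have inv: "matrix_inv (T ** transpose T) = transpose T' ** T'"
    by (intro matrix_inv_eqI) (simp add: tr T(3))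
  \<comment> \<open>The two summands of each factor live on complementary coordinate subspaces. Of
    the four products below, the mixed ones vanish and the others add up to \<open>Q + ?P\<close>,
    the identity.\<close>
  let ?P = "mat 1 - Q"
  have "(Q ** transpose T' ** T' ** Q) ** (T ** Q ** transpose T)
      = Q ** transpose T' ** T' ** (Q ** T ** Q) ** transpose T"
    by (simp only: matrix_mul_assoc)
  also have "\<dots> = Q ** transpose T' ** (T' ** T) ** Q ** transpose T"
    by (simp only: QTQ matrix_mul_assoc)
  also have "\<dots> = (Q ** transpose T' ** Q) ** transpose T"
    by (simp add: T'T)
  also have "\<dots> = Q ** (transpose T' ** transpose T)"
    by (simp only: QtT' matrix_mul_assoc)
  finally have 1: "(Q ** transpose T' ** T' ** Q) ** (T ** Q ** transpose T) = Q"
    by (simp add: tr)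
  have "(Q ** transpose T' ** T' ** Q) ** ?P = Q ** transpose T' ** T' ** (Q ** ?P)"
    by (simp only: matrix_mul_assoc)
  then have 2: "(Q ** transpose T' ** T' ** Q) ** ?P = 0"
    by (simp add: matrix_diff_ldistrib QQ)
  have "?P ** (T ** Q ** transpose T) = T ** Q ** transpose T - (Q ** T ** Q) ** transpose T"
    by (simp add: matrix_diff_rdistrib matrix_mul_assoc)
  then have 3: "?P ** (T ** Q ** transpose T) = 0"
    by (simp add: QTQ)
  have 4: "?P ** ?P = ?P"
    by (simp add: matrix_diff_ldistrib matrix_diff_rdistrib QQ)
  show ?thesis
    unfolding inv matrix_mul_assoc matrix_add_ldistrib matrix_add_rdistrib
    using 1 2 3 4 by (simp add: matrix_mul_assoc)
qed

text \<open>Telescoping: \<mu> is the least element of \<open>L\<close> at that element, and at any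
  other the gap to its predecessor. These are the weights that make a diagonal matrix a combination
  of flag projections.\<close>

lemma finite_set_partial_sums:
  assumes "finite (L :: real set)"
  shows "\<exists>\<mu>. \<forall>l\<in>L. l = (\<Sum>r\<in>L. if r \<le> l then \<mu> r else 0)"
  using assms
proof (induction L rule: finite_linorder_max_induct)
  case empty
  then show ?case by simp
next
  case (insert b A)
  then obtain \<mu> where \<mu>: "\<And>l. l \<in> A \<Longrightarrow> l = (\<Sum>r\<in>A. if r \<le> l then \<mu> r else 0)"
    by blast
  \<comment> \<open>The old weights sum to the previous maximum, or to 0 if \<open>A\<close> is
    empty; the new weight is what is missing to reach \<open>b\<close>.\<close>
  define \<nu> where "\<nu> = \<mu>(b := b - (\<Sum>r\<in>A. \<mu> r))"
  have "b \<notin> A"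
    using insert.hyps by auto
  then have \<nu>: "(\<Sum>r\<in>A. if r \<le> l then \<nu> r else 0) = (\<Sum>r\<in>A. if r \<le> l then \<mu> r else 0)" for l
    by (intro sum.cong) (auto simp: \<nu>_def)
  have "l = (\<Sum>r\<in>insert b A. if r \<le> l then \<nu> r else 0)" if "l \<in> insert b A" for l
  proof (cases "l = b")
    case True
    have "(\<Sum>r\<in>A. if r \<le> b then \<mu> r else 0) = (\<Sum>r\<in>A. \<mu> r)"
      using insert.hyps by (intro sum.cong) auto
    then show ?thesis
      using True insert.hyps \<open>b \<notin> A\<close> by (simp add: \<nu>) (simp add: \<nu>_def)
  next
    case False
    then have "l \<in> A" "\<not> b \<le> l"
      using that insert.hyps by auto
    then show ?thesis
      using insert.hyps \<open>b \<notin> A\<close> \<mu>[of l] by (simp add: \<nu>)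
  qed
  then show ?case
    by blast
qed

text \<open>Summing over the values of \<open>d\<close> rather than the indices counts each flag
  member once. The weights depend on \<open>d\<close> only, so one choice serves the triangular
  factors of all points.\<close>

lemma cdiag_flag_decomposition:
  obtains \<mu> where "\<And>g. cdiag g d = (\<Sum>r\<in>range d. \<mu> r *\<^sub>R (g ** flag_proj d r ** transpose g))"
proof -
  obtain \<mu> where \<mu>: "\<And>l. l \<in> range d \<Longrightarrow> l = (\<Sum>r\<in>range d. if r \<le> l then \<mu> r else 0)"
    using finite_set_partial_sums[of "range d"] by auto
  have "cdiag g d = (\<Sum>r\<in>range d. \<mu> r *\<^sub>R (g ** flag_proj d r ** transpose g))" for g
  proof -
    have "cdiag g d $ i $ j = (\<Sum>k\<in>UNIV. \<Sum>r\<in>range d. \<mu> r * ((if r \<le> d k then 1 else 0) * (g $ i $ k * g $ j $ k)))" for i j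
      unfolding cdiag_nth
    proof (rule sum.cong)
      fix k
      have d: "d k = (\<Sum>r\<in>range d. \<mu> r * (if r \<le> d k then 1 else 0))"
        using \<mu>[of "d k"] by (simp add: if_distrib cong: if_cong)
      show "d k * (g $ i $ k * g $ j $ k)
          = (\<Sum>r\<in>range d. \<mu> r * ((if r \<le> d k then 1 else 0) * (g $ i $ k * g $ j $ k)))"
        using arg_cong[OF d, of "\<lambda>s. s * (g $ i $ k * g $ j $ k)"]
        by (simp only: sum_distrib_right mult.assoc)
    qed simp
    also have "\<dots> i j = (\<Sum>r\<in>range d. \<mu> r *\<^sub>R cdiag g (\<lambda>k. if r \<le> d k then 1 else 0)) $ i $ j" for i j
      by (subst sum.swap) (simp add: sum_component cdiag_nth sum_distrib_left)
    finally show ?thesis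
      by (simp add: vec_eq_iff flag_proj_def cdiag_def)
  qed
  then show thesis
    using that by blast
qed

section \<open>Radial fields\<close>

text \<open>\<open>g\<close> and \<open>d\<close> are read off one representative of \<xi>. The
  points considered exhaust the manifold, as \<open>triangular_factorization\<close> shows after a
  congruence by the inverse of \<open>g\<close>.\<close>

lemma boundary_at_infinity_radial_field:
  fixes \<xi> :: "(real \<Rightarrow> real^'m^'m) set"
  assumes "\<xi> \<in> boundary_at_infinity"
  obtains g d where "invertible g"
    "\<And>T T'. triangular d T \<Longrightarrow> triangular d T' \<Longrightarrow> T ** T' = mat 1 \<Longrightarrow>
      radial_field \<xi> ((g ** T) ** transpose (g ** T)) = cdiag (g ** T) d"
proof -
  obtain \<alpha> where \<alpha>: "\<alpha> \<in> unit_rays" "\<xi> = asymptotic_rays `` {\<alpha>}"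
    using assms unfolding boundary_at_infinity_def by (rule quotientE)
  then obtain g d where g: "invertible g" "(\<Sum>i\<in>UNIV. (d i)\<^sup>2) = 1"
    and \<alpha>_eq: "\<alpha> = (\<lambda>t\<in>{0..}. cdiag g (\<lambda>i. exp (t * d i)))"
    unfolding unit_rays_iff by blast
  have "radial_field \<xi> ((g ** T) ** transpose (g ** T)) = cdiag (g ** T) d"
    if T: "triangular d T" "triangular d T'" "T ** T' = mat 1" for T T'
  proof -
    let ?\<delta> = "\<lambda>t. cdiag (g ** T) (\<lambda>i. exp (t * d i))"
    define \<beta> where "\<beta> = (\<lambda>t\<in>{0..}. ?\<delta> t)"
    have \<beta>: "(\<alpha>, \<beta>) \<in> asymptotic_rays"
      unfolding \<alpha>_eq \<beta>_def by (rule triangular_imp_asymptotic[OF g T])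
    have \<beta>_0: "\<beta> 0 = (g ** T) ** transpose (g ** T)"
      by (simp add: \<beta>_def cdiag_one)
    have "ray_from \<xi> ((g ** T) ** transpose (g ** T)) = \<beta>"
      unfolding ray_from_def
    proof (rule the_equality)
      show "\<beta> \<in> \<xi> \<and> \<beta> 0 = (g ** T) ** transpose (g ** T)"
        using \<beta> \<beta>_0 by (simp add: \<alpha>(2))
      show "\<gamma> = \<beta>" if "\<gamma> \<in> \<xi> \<and> \<gamma> 0 = (g ** T) ** transpose (g ** T)" for \<gamma>
        using that asymptotic_rays_unique[OF _ \<beta>, of \<gamma>] \<beta>_0 by (simp add: \<alpha>(2))
    qed
    moreover have "(\<beta> has_vector_derivative cdiag (g ** T) d) (at 0 within {0..})"
      by (rule has_vector_derivative_transform[OF _ _ cdiag_exp_has_vector_derivative])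
         (auto simp: \<beta>_def)
    \<comment> \<open>A nontrivial filter makes the one-sided derivative unique, so
      \<open>vector_derivative\<close> returns it.\<close>
    moreover have "at (0 :: real) within {0..} \<noteq> bot"
      by (simp add: at_within_Ici_at_right)
    ultimately show ?thesis
      unfolding radial_field_def by (simp add: vector_derivative_within)
  qed
  then show thesis
    using that g(1) by blast
qed

theorem corollary2p4:
  fixes \<xi> :: "(real \<Rightarrow> real^'m^'m) set"
  assumes "\<xi> \<in> boundary_at_infinity"
  shows "smooth_in sym_mats pd_mats (radial_field \<xi>)"
proof -
  obtain g d where g: "invertible g"
    and radial: "\<And>T T'. triangular d T \<Longrightarrow> triangular d T' \<Longrightarrow> T ** T' = mat 1 \<Longrightarrow>
      radial_field \<xi> ((g ** T) ** transpose (g ** T)) = cdiag (g ** T) d"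
    using boundary_at_infinity_radial_field[OF assms] by blast
  obtain \<mu> where \<mu>: "\<And>h. cdiag h d = (\<Sum>r\<in>range d. \<mu> r *\<^sub>R (h ** flag_proj d r ** transpose h))"
    using cdiag_flag_decomposition by blast
  define f where "f = matrix_inv g"
  have gf: "g ** f = mat 1"
    using g by (simp add: f_def matrix_mul_inv_right)
  then have f: "invertible f"
    using matrix_left_right_inverse invertible_right_inverse by blast
  have tgf: "transpose f ** transpose g = mat 1"
    by (simp add: matrix_transpose_mul[symmetric] gf)
  \<comment> \<open>The left factor in \<open>congruence_flag_proj\<close>, with
    \<open>f ** x ** transpose f\<close> in place of \<open>T ** transpose T\<close>, so that
    \<open>T\<close> is not mentioned.\<close>
  define M where "M r x = flag_proj d r ** matrix_inv (f ** x ** transpose f) ** flag_proj d r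
    + (mat 1 - flag_proj d r)" for r x
  define F where "F x = g ** (\<Sum>r\<in>range d. \<mu> r *\<^sub>R (matrix_inv (M r x) + - (mat 1 - flag_proj d r)))
    ** transpose g" for x
  \<comment> \<open>\<open>T\<close> is chosen for this single \<open>x\<close> and disappears from
    the conclusion; its identities also provide the invertibility that
    \<open>Ck_on_matrix_inv\<close> requires.\<close>
  have *: "radial_field \<xi> x = F x \<and> (\<forall>r. invertible (M r x))" if x: "x \<in> pd_mats" for x
  proof -
    obtain T T' where T: "triangular d T" "triangular d T'" "T ** T' = mat 1"
      and y: "f ** x ** transpose f = T ** transpose T"
      using triangular_factorization[OF congruence_in_pd_mats[OF x f]] by blast
    have M: "M r x ** (T ** flag_proj d r ** transpose T + (mat 1 - flag_proj d r)) = mat 1" for r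
      unfolding M_def y by (rule congruence_flag_proj[OF T])
    have "x = (g ** f) ** x ** (transpose f ** transpose g)"
      by (simp add: gf tgf)
    also have "\<dots> = g ** (f ** x ** transpose f) ** transpose g"
      by (simp only: matrix_mul_assoc)
    also have "\<dots> = (g ** T) ** transpose (g ** T)"
      by (simp add: y matrix_transpose_mul matrix_mul_assoc)
    finally have "radial_field \<xi> x = g ** cdiag T d ** transpose g"
      using radial[OF T] by (simp add: cdiag_congruence)
    then have "radial_field \<xi> x = F x"
      by (simp add: F_def matrix_inv_eqI[OF M] \<mu>)
    moreover have "invertible (M r x)" for r
      using M invertible_right_inverse by blast
    ultimately show ?thesis
      by blast
  qed
  have "Ck_on k sym_mats pd_mats F" for k
  proof -
    have inv: "Ck_on k sym_mats pd_mats (\<lambda>x. matrix_inv (f ** x ** transpose f))"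
      by (intro Ck_on_matrix_inv Ck_on_matrix_mult_const Ck_on_ident pd_mats_invertible
          congruence_in_pd_mats f)
    have "Ck_on k sym_mats pd_mats (M r)" for r
      unfolding M_def by (intro Ck_on_add Ck_on_matrix_mult_const Ck_on_const inv)
    then have "Ck_on k sym_mats pd_mats (\<lambda>x. matrix_inv (M r x))" for r
      using * by (intro Ck_on_matrix_inv) auto
    then have "Ck_on k sym_mats pd_mats
        (\<lambda>x. \<mu> r *\<^sub>R (matrix_inv (M r x) + - (mat 1 - flag_proj d r)))" for r
      by (intro Ck_on_bounded_linear[OF bounded_linear_scaleR_right] Ck_on_add Ck_on_const)
    then show ?thesis
      unfolding F_def by (intro Ck_on_matrix_mult_const Ck_on_sum)
  qed
  then have "Ck_on k sym_mats pd_mats (radial_field \<xi>)" for k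
    by (rule Ck_on_cong) (simp add: *)
  then show ?thesis
    by (simp add: smooth_in_def)
qed

end
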